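(* Let $(\varepsilon_i)_{i\in\mathbb{Z}}$ be independent and identically distributed real random variables, let $(\theta_k)_{k\in\mathbb{Z}}$ be real constants with $\theta_k=0$ for all but a finite number of values of $k$ and $\theta_k\neq 0$ for some $k$, and put $X_i=\sum_k\theta_k\varepsilon_{i+k}$ for $i\in\mathbb{Z}$. Let $0<\alpha<1$, put $\beta=-\log(1-\alpha)$, and let $t=t(\nu)$, for positive integers $\nu$, be real numbers such that $$P(X_0>t)=\frac{\beta}{\nu}+o(\nu^{-1})\qquad\text{as }\nu\to\infty.$$ Suppose that, for each integer $i_0\geq 1$, $$P\left(X_i>x\text{ for some }i\text{ with }1\leq|i|\leq i_0\mid X_0>x\right)\to 0\qquad\text{as }x\to\infty.$$ Let $1\leq I_1<I_2<\cdots$ denote the indices $i\geq 1$ for which $X_i>t$. Then, for each constant $C>0$, the point process with points $I_1\nu^{-1},I_2\nu^{-1},\ldots$, restricted to the interval $[0,C]$, converges weakly, as $\nu\to\infty$, to a homogeneous Poisson process on $[0,C]$ with intensity $\beta$.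
   Context: The process $X_i$ is stationary, so $X_0$ has the common marginal distribution of the $X_i$. The hypothesis on conditional probabilities is understood to include that $P(X_0>x)>0$ for all real $x$, so that the conditional probabilities are defined. Weak convergence of point processes is convergence in distribution, regarding the point processes as random counting measures on $[0,C]$. *)

theory Defs
  imports "HOL-Probability.Probability" "HOL-Library.Landau_Symbols"
begin

definition moving_average :: "(int \<Rightarrow> real) \<Rightarrow> (int \<Rightarrow> 'a \<Rightarrow> real) \<Rightarrow> int \<Rightarrow> 'a \<Rightarrow> real" where
  "moving_average \<theta> \<epsilon> i \<omega> = (\<Sum>k | \<theta> k \<noteq> 0. \<theta> k * \<epsilon> (i + k) \<omega>)"

definition counting_measures :: "real \<Rightarrow> real measure set" where
  "counting_measures C =
     {\<mu>. sets \<mu> = sets (restrict_space borel {0..C}) \<and>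
         (\<forall>A\<in>sets \<mu>. \<exists>n::nat. emeasure \<mu> A = of_nat n)}"

text \<open>The topology of weak convergence: the coarsest one for which \<open>\<mu> \<mapsto> \<integral> f d\<mu>\<close> is continuous
  for every continuous \<open>f\<close> on the compact interval \<open>[0, C]\<close> (where weak and vague convergence agree).\<close>

definition counting_topology :: "real \<Rightarrow> real measure topology" where
  "counting_topology C = topology_generated_by
     {{\<mu> \<in> counting_measures C. (\<integral>x. f x \<partial>\<mu>) \<in> U} | f U.
        continuous_on {0..C} (f :: real \<Rightarrow> real) \<and> open (U :: real set)}"

definition borel_of :: "'b topology \<Rightarrow> 'b measure" where
  "borel_of T = sigma (topspace T) {U. openin T U}"

text \<open>Convergence in distribution of random elements \<open>Y n\<close> of the space \<open>T\<close> to a random element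
  with law \<open>P\<close>; that each \<open>Y n\<close> is a random element of \<open>T\<close> is part of the assertion.\<close>

definition converges_in_distribution ::
  "'b topology \<Rightarrow> 'a measure \<Rightarrow> (nat \<Rightarrow> 'a \<Rightarrow> 'b) \<Rightarrow> 'b measure \<Rightarrow> bool" where
  "converges_in_distribution T M Y P \<longleftrightarrow>
     (\<forall>n. Y n \<in> M \<rightarrow>\<^sub>M borel_of T) \<and>
     prob_space P \<and> sets P = sets (borel_of T) \<and>
     (\<forall>h. continuous_map T euclideanreal h \<longrightarrow> (\<exists>B. \<forall>\<mu>\<in>topspace T. \<bar>h \<mu>\<bar> \<le> B) \<longrightarrow>
        (\<lambda>n. \<integral>\<omega>. h (Y n \<omega>) \<partial>M) \<longlonglongrightarrow> (\<integral>\<mu>. h \<mu> \<partial>P))"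

text \<open>The law of a homogeneous Poisson process on \<open>[0, C]\<close> with intensity \<open>\<beta>\<close>.  The Poisson weights
  are written out because the parameter \<open>\<beta> |A|\<close> may be zero, when the count is almost surely \<open>0\<close>.\<close>

definition poisson_process_law :: "real \<Rightarrow> real \<Rightarrow> real measure measure \<Rightarrow> bool" where
  "poisson_process_law C \<beta> P \<longleftrightarrow>
     prob_space P \<and> sets P = sets (borel_of (counting_topology C)) \<and>
     (\<forall>A n. A \<in> sets borel \<longrightarrow> A \<subseteq> {0..C} \<longrightarrow>
        \<P>(\<mu> in P. measure \<mu> A = real n)
          = exp (- (\<beta> * measure lborel A)) * (\<beta> * measure lborel A) ^ n / fact n) \<and>
     (\<forall>(J::nat set) A. finite J \<longrightarrow> disjoint_family_on A J \<longrightarrow>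
        (\<forall>j\<in>J. A j \<in> sets borel \<and> A j \<subseteq> {0..C}) \<longrightarrow>
        prob_space.indep_vars P (\<lambda>_. borel) (\<lambda>j \<mu>. measure \<mu> (A j)) J)"

text \<open>The counting measure on \<open>[0, C]\<close> with an atom of mass one at each point of \<open>S \<inter> [0, C]\<close>.\<close>

definition points_measure :: "real \<Rightarrow> real set \<Rightarrow> real measure" where
  "points_measure C S =
     distr (count_space (S \<inter> {0..C})) (restrict_space borel {0..C}) (\<lambda>x. x)"

definition exceedance_process ::
  "(int \<Rightarrow> 'a \<Rightarrow> real) \<Rightarrow> real \<Rightarrow> real \<Rightarrow> nat \<Rightarrow> 'a \<Rightarrow> real measure" where
  "exceedance_process X C u \<nu> \<omega> =
     points_measure C {real_of_int i / real \<nu> | i. 1 \<le> i \<and> X i \<omega> > u}"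

end

theory Submission
  imports Defs
begin

text \<open>A continuous functional on the space of counting measures is uniformly continuous on
  configurations with at most \<open>L\<close> points.  Divide \<open>[0, C]\<close> into \<open>k\<close> equal cells; if at most \<open>L\<close>
  points occur and no two of them share a cell, a configuration may be replaced by its set of occupied
  cells.  For the exceedances, remove the last \<open>2 r\<close> indices of every cell, where \<open>r\<close> bounds the range
  of the moving average: this makes the occupation events of different cells independent.  Two
  exceedances in one cell are either close together, which the conditional probability hypothesis
  excludes in the limit, or independent, which has probability \<open>O(1 / k\<^sup>2)\<close>.  Hence for large \<open>\<nu>\<close> the
  occupation probability of a cell differs by \<open>O(1 / k\<^sup>2)\<close> from that for the Poisson process, and
  the \<open>k\<close> cells contribute a total error of \<open>O(1 / k)\<close>.  The Poisson process is realised by a Poisson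
  number of independent uniform points.\<close>

section \<open>Finite configurations and the weak topology\<close>

text \<open>The topology on counting measures is given only by generators, without a metric, so
  uniform continuity of a test functional is sought in the coordinates of the points. For each
  \<open>n\<close> the map from positions to configurations is continuous on the compact cube, which
  yields a modulus there. It depends on \<open>n\<close>; hence the bound \<open>L\<close> on the
  number of points, and the order of choices: \<open>L\<close> from tail estimates, the distance
  \<open>d\<close> from \<open>L\<close>, the number \<open>k\<close> of cells from
  \<open>d\<close>, and \<open>\<nu>\<close> last. Configurations are indexed families rather than
  sets, so that coinciding points keep their multiplicity; otherwise total mass would jump when two
  points merge and the map would not be continuous. After discretisation both processes become
  random sets of independently occupied cells, and two such laws differ in L1 norm by at most twice
  the sum of the differences of the occupation probabilities. The conditional hypothesis speaks of
  levels tending to infinity. It applies along \<open>t\<close> because every tail probability of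
  \<open>X 0\<close> is positive, which forces \<open>t \<nu>\<close> above each level once its tail
  probability is small.\<close>

definition atoms_measure :: "real \<Rightarrow> 'i set \<Rightarrow> ('i \<Rightarrow> real) \<Rightarrow> real measure" where
  "atoms_measure C J y = distr (count_space J) (restrict_space borel {0..C}) y"

lemma points_measure_eq_atoms_measure:
  "points_measure C S = atoms_measure C (S \<inter> {0..C}) (\<lambda>x. x)"
  by (simp add: points_measure_def atoms_measure_def)

lemma sets_atoms_measure [simp]: "sets (atoms_measure C J y) = sets (restrict_space borel {0..C})"
  by (simp add: atoms_measure_def)

lemma space_atoms_measure [simp]: "space (atoms_measure C J y) = {0..C}"
  by (simp add: atoms_measure_def space_restrict_space)

lemma measurable_atoms:
  "y \<in> J \<rightarrow> {0..C} \<Longrightarrow> y \<in> count_space J \<rightarrow>\<^sub>M restrict_space borel {0..C}"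
  by (auto simp: space_restrict_space)

lemma emeasure_atoms_measure:
  assumes "finite J" "y \<in> J \<rightarrow> {0..C}" "A \<in> sets (restrict_space borel {0..C})"
  shows "emeasure (atoms_measure C J y) A = of_nat (card {j \<in> J. y j \<in> A})"
proof -
  have "emeasure (atoms_measure C J y) A = emeasure (count_space J) (y -` A \<inter> J)"
    unfolding atoms_measure_def using assms measurable_atoms[OF assms(2)]
    by (subst emeasure_distr) auto
  also have "\<dots> = of_nat (card (y -` A \<inter> J))"
    using assms(1) by (subst emeasure_count_space_finite) auto
  also have "y -` A \<inter> J = {j \<in> J. y j \<in> A}" by auto
  finally show ?thesis .
qed

lemma sets_restrict_borel_Icc:
  "A \<in> sets (restrict_space borel {0..C::real}) \<longleftrightarrow> A \<in> sets borel \<and> A \<subseteq> {0..C}"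
  by (subst sets_restrict_space_iff) auto

lemma measure_atoms_measure:
  assumes "finite J" "y \<in> J \<rightarrow> {0..C}" "A \<in> sets borel" "A \<subseteq> {0..C}"
  shows "measure (atoms_measure C J y) A = real (card {j \<in> J. y j \<in> A})"
  using emeasure_atoms_measure[of J y C A] assms
  by (simp add: measure_def sets_restrict_borel_Icc)

lemma atoms_measure_in_counting_measures:
  assumes "finite J" "y \<in> J \<rightarrow> {0..C}"
  shows "atoms_measure C J y \<in> counting_measures C"
  using emeasure_atoms_measure[OF assms] by (auto simp: counting_measures_def)

lemma atoms_measure_reindex:
  assumes "bij_betw b I J" "y \<in> J \<rightarrow> {0..C}"
  shows "atoms_measure C J y = atoms_measure C I (\<lambda>i. y (b i))"
proof -
  have "b \<in> count_space I \<rightarrow>\<^sub>M count_space J"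
    using assms(1) by (auto simp: bij_betw_def)
  then show ?thesis
    unfolding atoms_measure_def
    by (subst distr_bij_count_space[OF assms(1), symmetric], subst distr_distr)
       (use measurable_atoms[OF assms(2)] in \<open>auto simp: comp_def\<close>)
qed

lemma atoms_measure_cong:
  "(\<And>j. j \<in> J \<Longrightarrow> y j = z j) \<Longrightarrow> atoms_measure C J y = atoms_measure C J z"
  unfolding atoms_measure_def by (intro distr_cong) auto

lemma integral_atoms_measure:
  assumes "finite J" "y \<in> J \<rightarrow> {0..C}" "continuous_on {0..C} (f :: real \<Rightarrow> real)"
  shows "(\<integral>x. f x \<partial>atoms_measure C J y) = (\<Sum>j\<in>J. f (y j))"
  unfolding atoms_measure_def
  by (subst integral_distr)
     (use assms measurable_atoms[OF assms(2)] in
       \<open>auto intro: borel_measurable_continuous_on_restrict simp: lebesgue_integral_count_space_finite\<close>)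

lemma topspace_counting_topology [simp]: "topspace (counting_topology C) = counting_measures C"
proof -
  have "counting_measures C \<in> {{\<mu> \<in> counting_measures C. (\<integral>x. f x \<partial>\<mu>) \<in> U} | f U.
        continuous_on {0..C} (f :: real \<Rightarrow> real) \<and> open (U :: real set)}"
    \<comment> \<open>The zero function and the open set \<open>UNIV\<close> make the whole space
      one of the generators.\<close>
    by (intro CollectI exI[of _ "\<lambda>_. 0"] exI[of _ UNIV]) auto
  then show ?thesis
    unfolding counting_topology_def topology_generated_by_topspace by blast
qed

section \<open>Dependence of a configuration on the positions of its points\<close>

text \<open>A continuous retraction of the line onto the interval: the map from sequences to
  configurations becomes total, so it can be treated on the full product space, and a uniform sample
  gives a counting measure always rather than almost surely.\<close>

definition clamp_Icc :: "real \<Rightarrow> real \<Rightarrow> real" where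
  "clamp_Icc C x = max 0 (min C x)"

lemma clamp_Icc_in: "C > 0 \<Longrightarrow> clamp_Icc C x \<in> {0..C}"
  by (auto simp: clamp_Icc_def)

lemma clamp_Icc_id: "x \<in> {0..C} \<Longrightarrow> clamp_Icc C x = x"
  by (auto simp: clamp_Icc_def)

text \<open>It suffices to test the generators of the topology; there the integral becomes a finite
  sum of continuous functions of single coordinates. The domain consists of infinite sequences so
  that one type serves every \<open>n\<close>.\<close>

lemma continuous_map_atoms_measure:
  assumes "C > 0"
  shows "continuous_map euclidean (counting_topology C)
           (\<lambda>y::nat \<Rightarrow> real. atoms_measure C {..<n} (\<lambda>i. clamp_Icc C (y i)))" (is "continuous_map _ _ ?\<Phi>")
proof -
  have *: "?\<Phi> y \<in> counting_measures C" for y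
    using assms by (intro atoms_measure_in_counting_measures Pi_I clamp_Icc_in) auto
  have "continuous_map euclidean (counting_topology C) ?\<Phi>"
    unfolding counting_topology_def
  proof (rule continuous_on_generated_topo)
    fix U assume "U \<in> {{\<mu> \<in> counting_measures C. (\<integral>x. f x \<partial>\<mu>) \<in> U} | f U.
        continuous_on {0..C} (f :: real \<Rightarrow> real) \<and> open (U :: real set)}"
    then obtain f V where f: "continuous_on {0..C} (f :: real \<Rightarrow> real)" "open (V :: real set)"
      and U: "U = {\<mu> \<in> counting_measures C. (\<integral>x. f x \<partial>\<mu>) \<in> V}"
      by blast
    have "(\<lambda>i. clamp_Icc C (y i)) \<in> {..<n} \<rightarrow> {0..C}" for y :: "nat \<Rightarrow> real"
      using assms by (intro Pi_I clamp_Icc_in)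
    then have "?\<Phi> -` U = (\<lambda>y. \<Sum>i<n. f (clamp_Icc C (y i))) -` V"
      using * f by (auto simp: U integral_atoms_measure)
    moreover have "continuous_on UNIV (\<lambda>y::nat \<Rightarrow> real. f (clamp_Icc C (y i)))" for i
    proof (rule continuous_on_compose2[OF f(1)])
      show "continuous_on UNIV (\<lambda>y::nat \<Rightarrow> real. clamp_Icc C (y i))"
        unfolding clamp_Icc_def by (intro continuous_intros continuous_on_product_coordinates)
    qed (use clamp_Icc_in[OF assms] in auto)
    then have "continuous_on UNIV (\<lambda>y::nat \<Rightarrow> real. \<Sum>i<n. f (clamp_Icc C (y i)))"
      by (intro continuous_on_sum)
    ultimately show "openin euclidean (?\<Phi> -` U \<inter> topspace euclidean)"
      using f(2) by (simp add: open_vimage)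
  next
    show "?\<Phi> ` topspace euclidean \<subseteq> \<Union>{{\<mu> \<in> counting_measures C. (\<integral>x. f x \<partial>\<mu>) \<in> U} | f U.
        continuous_on {0..C} (f :: real \<Rightarrow> real) \<and> open (U :: real set)}"
      using * topspace_counting_topology[of C]
      unfolding counting_topology_def topology_generated_by_topspace by blast
  qed
  then show ?thesis .
qed

text \<open>The cube \<open>K\<close> is compact by Tychonoff, so the pulled-back functional
  \<open>g\<close> is uniformly continuous on it; closeness in the product metric is then reduced to
  closeness of the first \<open>n\<close> coordinates.\<close>

lemma atoms_measure_uniformly_continuous:
  fixes h :: "real measure \<Rightarrow> real"
  assumes "C > 0" "continuous_map (counting_topology C) euclideanreal h" "e > 0"
  shows "\<exists>d>0. \<forall>y z. y \<in> {..<n} \<rightarrow> {0..C} \<longrightarrow> z \<in> {..<n} \<rightarrow> {0..C} \<longrightarrow> (\<forall>i<n. \<bar>y i - z i\<bar> < d) \<longrightarrow>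
           \<bar>h (atoms_measure C {..<n} y) - h (atoms_measure C {..<n::nat} z)\<bar> < e"
proof -
  define g where "g y = h (atoms_measure C {..<n} (\<lambda>i. clamp_Icc C (y i)))" for y
  have "continuous_map euclidean euclideanreal g"
    unfolding g_def
    using continuous_map_compose[OF continuous_map_atoms_measure[OF assms(1)] assms(2)]
    by (simp add: comp_def)
  then have "continuous_on UNIV g" by simp
  then have g: "continuous_on K g" for K by (rule continuous_on_subset) simp
  define K :: "(nat \<Rightarrow> real) set" where "K = (\<Pi>\<^sub>E i\<in>UNIV. {0..C})"
  have "compactin (product_topology (\<lambda>_. euclideanreal) UNIV) K"
    unfolding K_def by (subst compactin_PiE) auto
  then have "compact K" by (simp add: euclidean_product_topology)
  then have "uniformly_continuous_on K g" using g by (intro compact_uniformly_continuous) auto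
  then obtain d where d: "d > 0" "\<And>x x'. x \<in> K \<Longrightarrow> x' \<in> K \<Longrightarrow> dist x' x < d \<Longrightarrow> dist (g x') (g x) < e"
    using assms(3) unfolding uniformly_continuous_on_def by metis
  \<comment> \<open>The product distance is at most twice the largest of finitely many coordinate
    distances plus \<open>(1/2) ^ N\<close>. Allotting \<open>d / 2\<close> to each part gives the
    coordinate tolerance \<open>d / 4\<close> below.\<close>
  obtain N :: nat where N: "(1/2) ^ N < d / 2"
    using real_arch_pow_inv[of "d / 2" "1/2"] d(1) by auto
  show ?thesis
  proof (intro exI[of _ "d / 4"] conjI allI impI)
    show "d / 4 > 0" using d(1) by simp
    fix y z assume yz: "y \<in> {..<n} \<rightarrow> {0..C}" "z \<in> {..<n} \<rightarrow> {0..C}" "\<forall>i<n. \<bar>y i - z i\<bar> < d / 4"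
    \<comment> \<open>Setting the coordinates from \<open>n\<close> on to 0 keeps both sequences in
      the cube and makes them agree there.\<close>
    define y' where "y' i = (if i < n then y i else 0)" for i
    define z' where "z' i = (if i < n then z i else 0)" for i
    have K: "y' \<in> K" "z' \<in> K" using yz assms(1) by (auto simp: K_def y'_def z'_def Pi_iff)
    have "dist y' z' \<le> 2 * Max {dist (y' (from_nat n)) (z' (from_nat n))|n. n \<le> N} + (1/2)^N"
      by (rule dist_fun_le_dist_first_terms)
    also have "Max {dist (y' (from_nat n)) (z' (from_nat n))|n. n \<le> N} \<le> d / 4"
      using yz(3) d(1)
      by (subst Max_le_iff) (auto simp: y'_def z'_def dist_real_def intro!: exI[of _ 0] less_imp_le)
    finally have "dist y' z' < d" using N by simp
    then have "dist (g y') (g z') < e" using d(2) K by blast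
    moreover have "g y' = h (atoms_measure C {..<n} y)" "g z' = h (atoms_measure C {..<n} z)"
      unfolding g_def using yz
      by (auto intro!: arg_cong[of _ _ h] atoms_measure_cong simp: y'_def z'_def Pi_iff clamp_Icc_id)
    ultimately show "\<bar>h (atoms_measure C {..<n} y) - h (atoms_measure C {..<n} z)\<bar> < e"
      by (simp add: dist_real_def)
  qed
qed

text \<open>One distance for all configurations of at most \<open>L\<close> points, kept as a
  predicate so that the exceedances and the Poisson points can share the same
  \<open>d\<close>.\<close>

definition atoms_modulus :: "real \<Rightarrow> (real measure \<Rightarrow> real) \<Rightarrow> nat \<Rightarrow> real \<Rightarrow> real \<Rightarrow> bool" where
  "atoms_modulus C h L e d \<longleftrightarrow>
     (\<forall>n\<le>L. \<forall>y z. y \<in> {..<n} \<rightarrow> {0..C} \<longrightarrow> z \<in> {..<n} \<rightarrow> {0..C} \<longrightarrow> (\<forall>i<n. \<bar>y i - z i\<bar> < d) \<longrightarrow>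
        \<bar>h (atoms_measure C {..<n} y) - h (atoms_measure C {..<n} z)\<bar> < e)"

lemma atoms_modulus_exists:
  assumes "C > 0" "continuous_map (counting_topology C) euclideanreal h" "e > 0"
  obtains d where "d > 0" "atoms_modulus C h L e d"
proof -
  have "\<exists>d. \<forall>n::nat. d n > 0 \<and> (\<forall>y z. y \<in> {..<n} \<rightarrow> {0..C} \<longrightarrow> z \<in> {..<n} \<rightarrow> {0..C} \<longrightarrow> (\<forall>i<n. \<bar>y i - z i\<bar> < d n) \<longrightarrow>
           \<bar>h (atoms_measure C {..<n} y) - h (atoms_measure C {..<n} z)\<bar> < e)"
    using atoms_measure_uniformly_continuous[OF assms] by metis
  then obtain d where d: "\<And>n::nat. d n > 0" "\<And>n y z. y \<in> {..<n::nat} \<rightarrow> {0..C} \<Longrightarrow> z \<in> {..<n} \<rightarrow> {0..C} \<Longrightarrow>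
      (\<And>i. i < n \<Longrightarrow> \<bar>y i - z i\<bar> < d n) \<Longrightarrow>
           \<bar>h (atoms_measure C {..<n} y) - h (atoms_measure C {..<n} z)\<bar> < e"
    by metis
  have "Min (d ` {..L}) \<le> d n" if "n \<le> L" for n using that by (intro Min_le) auto
  then have "atoms_modulus C h L e (Min (d ` {..L}))"
    unfolding atoms_modulus_def by (intro allI impI d(2)) (auto intro: order.strict_trans2)
  moreover have "Min (d ` {..L}) > 0" using d(1) by (subst Min_gr_iff) auto
  ultimately show ?thesis using that by blast
qed

text \<open>Enumerating \<open>J\<close> carries the modulus from initial segments of the naturals
  to arbitrary finite index sets, such as sets of exceedance times.\<close>

lemma atoms_modulusD:
  assumes h: "atoms_modulus C h L e d"
    and J: "finite J" "card J \<le> L" "y \<in> J \<rightarrow> {0..C}" "z \<in> J \<rightarrow> {0..C}"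
    and d: "\<And>j. j \<in> J \<Longrightarrow> \<bar>y j - z j\<bar> < d"
  shows "\<bar>h (atoms_measure C J y) - h (atoms_measure C J z)\<bar> < e"
proof -
  obtain b where b: "bij_betw b {..<card J} J"
    using ex_bij_betw_nat_finite[OF J(1)] by (auto simp: atLeast0LessThan)
  then have bJ: "b i \<in> J" if "i < card J" for i
    using that by (auto simp: bij_betw_def)
  have "(\<lambda>i. y (b i)) \<in> {..<card J} \<rightarrow> {0..C}" "(\<lambda>i. z (b i)) \<in> {..<card J} \<rightarrow> {0..C}"
    "\<forall>i<card J. \<bar>y (b i) - z (b i)\<bar> < d"
    using J(3,4) bJ d by blast+
  then show ?thesis
    using h J(2)
    unfolding atoms_measure_reindex[OF b J(3)] atoms_measure_reindex[OF b J(4)] atoms_modulus_def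
    by blast
qed

section \<open>The Borel sigma-algebra of the space of counting measures\<close>

lemma space_borel_of_counting [simp]: "space (borel_of (counting_topology C)) = counting_measures C"
  by (simp add: borel_of_def space_measure_of_conv)

lemma openin_subset_Pow: "{U. openin T U} \<subseteq> Pow (topspace T)"
  by (auto dest: openin_subset)

lemma sets_borel_of: "sets (borel_of T) = sigma_sets (topspace T) {U. openin T U}"
  unfolding borel_of_def using openin_subset_Pow[of T] by (rule sets_measure_of)

lemma measurable_borel_ofI:
  assumes "f \<in> space M \<rightarrow> topspace T" "\<And>U. openin T U \<Longrightarrow> f -` U \<inter> space M \<in> sets M"
  shows "f \<in> M \<rightarrow>\<^sub>M borel_of T"
  unfolding borel_of_def using assms openin_subset_Pow[of T] by (intro measurable_measure_of) auto

lemma continuous_map_borel_measurable: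
  assumes "continuous_map T euclideanreal h"
  shows "h \<in> borel_measurable (borel_of T)"
proof (rule borel_measurableI)
  fix S :: "real set" assume "open S"
  then have "openin T {x \<in> topspace T. h x \<in> S}"
    using assms by (intro openin_continuous_map_preimage[of _ euclideanreal]) auto
  moreover have "h -` S \<inter> space (borel_of T) = {x \<in> topspace T. h x \<in> S}"
    by (auto simp: borel_of_def space_measure_of_conv)
  ultimately show "h -` S \<inter> space (borel_of T) \<in> sets (borel_of T)"
    unfolding sets_borel_of by auto
qed

lemma continuous_map_integral:
  assumes "continuous_on {0..C} (f :: real \<Rightarrow> real)"
  shows "continuous_map (counting_topology C) euclideanreal (\<lambda>\<mu>. \<integral>x. f x \<partial>\<mu>)"
  unfolding continuous_map
proof (intro conjI allI impI)
  fix U :: "real set" assume "openin euclideanreal U"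
  then have "{\<mu> \<in> counting_measures C. (\<integral>x. f x \<partial>\<mu>) \<in> U} \<in> {{\<mu> \<in> counting_measures C. (\<integral>x. f x \<partial>\<mu>) \<in> U} | f U.
        continuous_on {0..C} (f :: real \<Rightarrow> real) \<and> open (U :: real set)}"
    using assms by auto
  then show "openin (counting_topology C) {x \<in> topspace (counting_topology C). (\<integral>y. f y \<partial>x) \<in> U}"
    unfolding topspace_counting_topology unfolding counting_topology_def
    by (rule topology_generated_by_Basis)
qed auto

lemma counting_measures_finite:
  assumes "\<mu> \<in> counting_measures C"
  shows "finite_measure \<mu>" "sets \<mu> = sets (restrict_space borel {0..C})" "space \<mu> = {0..C}"
proof -
  show *: "sets \<mu> = sets (restrict_space borel {0..C})"
    using assms by (auto simp: counting_measures_def)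
  then show "space \<mu> = {0..C}"
    by (auto dest: sets_eq_imp_space_eq simp: space_restrict_space)
  show "finite_measure \<mu>"
  proof
    obtain n :: nat where "emeasure \<mu> (space \<mu>) = of_nat n"
      using assms by (force simp: counting_measures_def)
    then show "emeasure \<mu> (space \<mu>) \<noteq> \<infinity>" by simp
  qed
qed

text \<open>For closed \<open>S\<close> the count is the limit of integrals of the continuous
  functions \<open>f n\<close>, which decrease to the indicator of \<open>S\<close>. Closed sets are
  stable under intersection, so a Dynkin argument reaches all Borel sets. This is what makes the
  counts in the Poisson law random variables.\<close>

lemma measurable_measure_counting:
  fixes A :: "real set"
  assumes "A \<in> sets borel" 
  shows "(\<lambda>\<mu>. measure \<mu> (A \<inter> {0..C})) \<in> borel_measurable (borel_of (counting_topology C))"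
proof -
  let ?B = "borel_of (counting_topology C)"
  have int: "Int_stable {S :: real set. closed S}" by (auto simp: Int_stable_def)
  have gen: "{S :: real set. closed S} \<subseteq> Pow UNIV" by auto
  have A: "A \<in> sigma_sets UNIV {S :: real set. closed S}"
    using assms by (simp add: borel_eq_closed)
  have sets: "S \<inter> {0..C} \<in> sets \<mu>" if "S \<in> sets borel" "\<mu> \<in> space ?B" for S \<mu>
    using that counting_measures_finite(2)[of \<mu> C] by (auto simp: sets_restrict_borel_Icc)
  show ?thesis
    using int gen A
  proof (induction rule: sigma_sets_induct_disjoint)
    case (basic S)
    show ?case
    \<comment> \<open>The distance \<open>infdist\<close> to the empty set is 0 by convention, so
      the functions \<open>f n\<close> would be constantly 1 there.\<close>
    proof (cases "S = {}")
      case False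
      have S: "closed S" using basic by simp
      define f where "f n x = max 0 (1 - real n * infdist x S)" for n x
      have f_lim: "(\<lambda>n. f n x) \<longlonglongrightarrow> indicator S x" for x
      proof (cases "x \<in> S")
        case True
        then show ?thesis by (simp add: f_def)
      next
        case False
        then have "infdist x S > 0"
          using S \<open>S \<noteq> {}\<close> by (simp add: infdist_pos_not_in_closed)
        then have "filterlim (\<lambda>n. real n * infdist x S) at_top sequentially"
          by (intro filterlim_at_top_mult_tendsto_pos[OF tendsto_const] filterlim_real_sequentially)
             auto
        then have "eventually (\<lambda>n. real n * infdist x S \<ge> 1) sequentially"
          by (simp add: filterlim_at_top)
        then have "eventually (\<lambda>n. f n x = indicator S x) sequentially"
          by eventually_elim (use False in \<open>auto simp: f_def\<close>)
        then show ?thesis by (rule tendsto_eventually)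
      qed
      have cont: "continuous_on {0..C} (f n)" for n
        unfolding f_def by (intro continuous_intros)
      show ?thesis
      proof (rule borel_measurable_LIMSEQ_real)
        show "(\<lambda>\<mu>. \<integral>x. f n x \<partial>\<mu>) \<in> borel_measurable ?B" for n
          by (intro continuous_map_borel_measurable continuous_map_integral cont)
        fix \<mu> assume mu: "\<mu> \<in> space ?B"
        then have m: "\<mu> \<in> counting_measures C" by simp
        interpret finite_measure \<mu> using counting_measures_finite(1)[OF m] .
        have ms: "borel_measurable (restrict_space borel {0..C}) = borel_measurable \<mu>"
          using counting_measures_finite(2)[OF m] by (intro measurable_cong_sets) auto
        have "(\<lambda>n. \<integral>x. f n x \<partial>\<mu>) \<longlonglongrightarrow> (\<integral>x. indicator S x \<partial>\<mu>)"
        proof (rule integral_dominated_convergence[where w = "\<lambda>_. 1"])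
          show "f n \<in> borel_measurable \<mu>" for n
            using borel_measurable_continuous_on_restrict[OF cont] ms by blast
          show "(indicator S :: real \<Rightarrow> real) \<in> borel_measurable \<mu>"
            unfolding ms[symmetric] using S
            by (intro measurable_restrict_space1 borel_measurable_indicator) auto
        qed (use f_lim in \<open>auto simp: f_def infdist_nonneg\<close>)
        also have "(\<integral>x. indicator S x \<partial>\<mu>) = measure \<mu> (S \<inter> {0..C})"
          by (simp add: counting_measures_finite(3)[OF m])
        finally show "(\<lambda>n. \<integral>x. f n x \<partial>\<mu>) \<longlonglongrightarrow> measure \<mu> (S \<inter> {0..C})" .
      qed
    qed simp
  next
    case empty
    then show ?case by simp
  next
    case (compl S)
    have S: "S \<in> sets borel" using compl by (simp add: borel_eq_closed)
    \<comment> \<open>Complements require the total mass, a continuous functional because it is the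
      integral of the constant 1.\<close>
    have one: "(\<lambda>\<mu>. measure \<mu> {0..C}) \<in> borel_measurable ?B"
    proof -
      have "(\<lambda>\<mu>. \<integral>x. 1 \<partial>\<mu> :: real) \<in> borel_measurable ?B"
        by (intro continuous_map_borel_measurable continuous_map_integral continuous_intros)
      then show ?thesis
        by (subst (asm) measurable_cong[where g = "\<lambda>\<mu>. measure \<mu> {0..C}"])
           (auto simp: counting_measures_finite(3))
    qed
    have "measure \<mu> ((UNIV - S) \<inter> {0..C}) = measure \<mu> {0..C} - measure \<mu> (S \<inter> {0..C})"
      if "\<mu> \<in> space ?B" for \<mu>
    proof -
      have m: "\<mu> \<in> counting_measures C" using that by simp
      interpret finite_measure \<mu> using counting_measures_finite(1)[OF m] .
      have "(UNIV - S) \<inter> {0..C} = space \<mu> - S \<inter> {0..C}"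
        using counting_measures_finite(3)[OF m] by auto
      then show ?thesis
        using finite_measure_compl[OF sets[OF S that]] counting_measures_finite(3)[OF m] by simp
    qed
    then show ?case
      using borel_measurable_diff[OF one compl.IH] by (subst measurable_cong) auto
  next
    case (union S)
    have S: "S i \<in> sets borel" for i using union by (auto simp: borel_eq_closed)
    have "measure \<mu> ((\<Union>i. S i) \<inter> {0..C}) = (\<Sum>i. measure \<mu> (S i \<inter> {0..C}))"
      if "\<mu> \<in> space ?B" for \<mu>
    proof -
      have m: "\<mu> \<in> counting_measures C" using that by simp
      interpret finite_measure \<mu> using counting_measures_finite(1)[OF m] .
      have "(\<lambda>i. measure \<mu> (S i \<inter> {0..C})) sums measure \<mu> (\<Union>i. S i \<inter> {0..C})"
        using sets[OF S that] union(1)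
        by (intro finite_measure_UNION) (auto simp: disjoint_family_on_def)
      then show ?thesis by (simp add: sums_iff)
    qed
    then show ?case
      using union by (subst measurable_cong) (auto intro: borel_measurable_suminf)
  qed
qed

section \<open>Poisson numbers of independent points\<close>

text \<open>The space of count vectors is countable, so point masses determine a law. The product
  formula therefore identifies the joint law with the product of the \<open>p j\<close>, which
  contains both the independence and the marginals.\<close>

lemma (in prob_space) indep_vars_countI:
  assumes J: "finite J" "J \<noteq> {}"
    and K [measurable]: "\<And>j. j \<in> J \<Longrightarrow> K j \<in> M \<rightarrow>\<^sub>M count_space (UNIV :: nat set)"
    and c: "\<And>c. \<P>(\<omega> in M. \<forall>j\<in>J. K j \<omega> = c j) = (\<Prod>j\<in>J. pmf (p j) (c j))"
  shows "indep_vars (\<lambda>_. count_space UNIV) K J"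
    and "j \<in> J \<Longrightarrow> distr M (count_space UNIV) (K j) = measure_pmf (p j)"
proof -
  let ?N = "PiM J (\<lambda>_. count_space (UNIV :: nat set))"
  let ?D = "distr M ?N (\<lambda>\<omega>. \<lambda>j\<in>J. K j \<omega>)"
  have meas: "(\<lambda>\<omega>. \<lambda>j\<in>J. K j \<omega>) \<in> M \<rightarrow>\<^sub>M ?N" by measurable
  interpret P: product_prob_space "\<lambda>j. measure_pmf (p j)" J ..
  have sets: "sets (PiM J (\<lambda>j. measure_pmf (p j))) = sets ?N"
    by (intro sets_PiM_cong) auto
  have sing: "{a} \<in> sets ?N" if "a \<in> PiE J (\<lambda>_. UNIV)" for a
    by (subst count_space_PiM_finite) (use J that in auto)
  have eq: "?D = PiM J (\<lambda>j. measure_pmf (p j))"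
  proof (rule measure_eqI_countable')
    show "space ?D = PiE J (\<lambda>_. UNIV)" "space (PiM J (\<lambda>j. measure_pmf (p j))) = PiE J (\<lambda>_. UNIV)"
      by (auto simp: space_PiM)
    show "countable (PiE J (\<lambda>_. UNIV :: nat set))" using J by (intro countable_PiE) auto
    fix a :: "'b \<Rightarrow> nat" assume a: "a \<in> PiE J (\<lambda>_. UNIV)"
    show "{a} \<in> sets ?D" using sing[OF a] by simp
    show "{a} \<in> sets (PiM J (\<lambda>j. measure_pmf (p j)))" using sing[OF a] sets by simp
    have "(\<lambda>\<omega>. \<lambda>j\<in>J. K j \<omega>) -` {a} \<inter> space M = {\<omega>\<in>space M. \<forall>j\<in>J. K j \<omega> = a j}"
    proof (intro equalityI subsetI)
      fix \<omega> assume "\<omega> \<in> (\<lambda>\<omega>. \<lambda>j\<in>J. K j \<omega>) -` {a} \<inter> space M"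
      then show "\<omega> \<in> {\<omega>\<in>space M. \<forall>j\<in>J. K j \<omega> = a j}" by auto
    next
      fix \<omega> assume "\<omega> \<in> {\<omega>\<in>space M. \<forall>j\<in>J. K j \<omega> = a j}"
      then show "\<omega> \<in> (\<lambda>\<omega>. \<lambda>j\<in>J. K j \<omega>) -` {a} \<inter> space M"
        using a by (auto simp: fun_eq_iff PiE_def extensional_def)
    qed
    then have "emeasure ?D {a} = ennreal (\<Prod>j\<in>J. pmf (p j) (a j))"
      using sing[OF a] meas by (simp add: emeasure_distr emeasure_eq_measure c)
    also have "\<dots> = (\<Prod>j\<in>J. emeasure (measure_pmf (p j)) {a j})"
      by (simp add: emeasure_pmf_single prod_ennreal)
    also have "\<dots> = emeasure (PiM J (\<lambda>j. measure_pmf (p j))) (PiE J (\<lambda>j. {a j}))"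
      using J by (subst P.emeasure_PiM) auto
    also have "PiE J (\<lambda>j. {a j}) = {a}"
      using a by (intro PiE_singleton) (auto simp: PiE_def)
    finally show "emeasure ?D {a} = emeasure (PiM J (\<lambda>j. measure_pmf (p j))) {a}" .
  qed
  show distr: "distr M (count_space UNIV) (K j) = measure_pmf (p j)" if j: "j \<in> J" for j
  proof -
    have "measure_pmf (p j) = distr (PiM J (\<lambda>j. measure_pmf (p j))) (measure_pmf (p j)) (\<lambda>\<omega>. \<omega> j)"
      using j by (subst distr_PiM_component) (auto simp: prob_space_measure_pmf)
    also have "\<dots> = distr (PiM J (\<lambda>j. measure_pmf (p j))) (count_space UNIV) (\<lambda>\<omega>. \<omega> j)"
      by (intro distr_cong) auto
    also have "\<dots> = distr M (count_space UNIV) (\<lambda>\<omega>. (\<lambda>j\<in>J. K j \<omega>) j)"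
      unfolding eq[symmetric] using meas j
      by (subst distr_distr) (auto simp: comp_def)
    finally show ?thesis using j by simp
  qed
  show "indep_vars (\<lambda>_. count_space UNIV) K J"
    using J K eq distr by (subst indep_vars_iff_distr_eq_PiM') (auto cong: PiM_cong)
qed

text \<open>Both sides say that the same joint law is a product. This transports independence of
  counts from the sample space of the points to the law of the random measure.\<close>

lemma (in prob_space) indep_vars_distr_iff:
  assumes f: "f \<in> M \<rightarrow>\<^sub>M N" and X: "\<And>i. i \<in> I \<Longrightarrow> X i \<in> N \<rightarrow>\<^sub>M M' i"
  shows "prob_space.indep_vars (distr M N f) M' X I \<longleftrightarrow> indep_vars M' (\<lambda>i \<omega>. X i (f \<omega>)) I"
proof -
  interpret D: prob_space "distr M N f" using f by (rule prob_space_distr)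
  show ?thesis
  \<comment> \<open>The product-law criterion used below assumes a nonempty index set.\<close>
  proof (cases "I = {}")
    case True
    then show ?thesis by (simp add: D.indep_vars_def indep_vars_def D.indep_sets_def indep_sets_def)
  next
    case False
    have "(\<lambda>x. \<lambda>i\<in>I. X i x) \<in> N \<rightarrow>\<^sub>M PiM I M'"
      using X by (intro measurable_restrict)
    then show ?thesis
      using f X False
      by (subst D.indep_vars_iff_distr_eq_PiM')
         (auto simp: indep_vars_iff_distr_eq_PiM' distr_distr comp_def measurable_compose[OF f] cong: PiM_cong)
  qed
qed

lemma (in prob_space) indep_vars_reindex:
  assumes f: "inj_on f I" and X: "indep_vars M' X (f ` I)"
  shows "indep_vars (\<lambda>i. M' (f i)) (\<lambda>i. X (f i)) I"
  unfolding indep_vars_def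
proof (intro conjI ballI)
  let ?F = "\<lambda>i. sigma_sets (space M) {X i -` A \<inter> space M |A. A \<in> sets (M' i)}"
  show "X (f i) \<in> M \<rightarrow>\<^sub>M M' (f i)" if "i \<in> I" for i
    using X that by (auto simp: indep_vars_def)
  have F: "indep_sets ?F (f ` I)" using X by (auto simp: indep_vars_def)
  show "indep_sets (\<lambda>i. ?F (f i)) I"
  proof (rule indep_setsI)
    show "?F (f i) \<subseteq> events" if "i \<in> I" for i
      using F that by (auto simp: indep_sets_def)
    fix A J assume J: "J \<noteq> {}" "J \<subseteq> I" "finite J" "\<forall>j\<in>J. A j \<in> ?F (f j)"
    have inj: "inj_on f J" using f J(2) by (rule inj_on_subset)
    define B where "B k = A (the_inv_into J f k)" for k
    have B: "B (f j) = A j" if "j \<in> J" for j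
      using inj that by (simp add: B_def the_inv_into_f_f)
    have "prob (\<Inter>k\<in>f ` J. B k) = (\<Prod>k\<in>f ` J. prob (B k))"
      using J B by (intro indep_setsD[OF F]) auto
    then show "prob (\<Inter>j\<in>J. A j) = (\<Prod>j\<in>J. prob (A j))"
      using B inj by (simp add: prod.reindex)
  qed
qed

section \<open>Multinomial counts and Poisson splitting\<close>

text \<open>This is the multinomial probability. Splitting off the last value \<open>k\<close>
  lowers \<open>c k\<close> by one and contributes the share \<open>c k\<close> of the total
  \<open>n + 1\<close>; summing the shares turns \<open>fact n\<close> into
  \<open>fact (Suc n)\<close>.\<close>

lemma sum_prod_functions_with_counts:
  fixes q :: "'j \<Rightarrow> real"
  assumes "finite J"
  shows "(\<Sum>f\<in>{..<n} \<rightarrow>\<^sub>E J. of_bool (\<forall>j\<in>J. card {i. i < n \<and> f i = j} = c j) * (\<Prod>i<n. q (f i)))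
       = (if (\<Sum>j\<in>J. c j) = n then fact n * (\<Prod>j\<in>J. q j ^ c j / fact (c j)) else 0)"
proof (induction n arbitrary: c)
  case 0
  have "(\<forall>j\<in>J. 0 = c j) \<longleftrightarrow> (\<Sum>j\<in>J. c j) = 0" using assms by auto
  moreover have "(\<Prod>j\<in>J. q j ^ c j / fact (c j)) = 1" if "(\<Sum>j\<in>J. c j) = 0"
    using that assms by (intro prod.neutral) auto
  ultimately show ?case by (auto simp: of_bool_def)
next
  case (Suc n)
  define V where "V c = (\<Prod>j\<in>J. q j ^ c j / fact (c j))" for c
  define F where "F n c f \<longleftrightarrow> (\<forall>j\<in>J. card {i. i < n \<and> f i = j} = c j)"
    for n :: nat and c :: "'j \<Rightarrow> nat" and f :: "nat \<Rightarrow> 'j"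
  have card: "card {i. i < Suc n \<and> (g(n := k)) i = j} = card {i. i < n \<and> g i = j} + of_bool (k = j)" for g k j
  proof -
    have "{i. i < Suc n \<and> (g(n := k)) i = j} = {i. i < n \<and> g i = j} \<union> (if k = j then {n} else {})"
      by auto
    then show ?thesis by (auto simp: card_insert_if)
  qed
  \<comment> \<open>The condition \<open>c k > 0\<close> guards the truncated subtraction: for
    \<open>c k = 0\<close> the lowered vector would be \<open>c\<close> itself.\<close>
  have F_Suc: "F (Suc n) c (g(n := k)) \<longleftrightarrow> c k > 0 \<and> F n (c(k := c k - 1)) g" if "k \<in> J" for g k
    unfolding F_def card using that by (auto simp: of_bool_def fun_upd_def split: if_splits)
  have V_upd: "q k * V (c(k := c k - 1)) = real (c k) * V c" if "k \<in> J" and ck: "c k > 0" for k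
  proof -
    define R where "R = (\<Prod>j\<in>J - {k}. q j ^ c j / fact (c j))"
    obtain m where m: "c k = Suc m" using gr0_implies_Suc[OF ck] by blast
    have "(\<Prod>j\<in>J - {k}. q j ^ (c(k := c k - 1)) j / fact ((c(k := c k - 1)) j)) = R"
      unfolding R_def by (intro prod.cong) auto
    then have 1: "V (c(k := c k - 1)) = q k ^ m / fact m * R"
      unfolding V_def using assms that(1) by (subst prod.remove[of J k]) (simp_all add: m)
    have 2: "V c = q k ^ Suc m / fact (Suc m) * R"
      unfolding V_def R_def using assms that(1) by (subst prod.remove[of J k]) (simp_all add: m)
    have "q k * (q k ^ m / fact m) = real (Suc m) * (q k ^ Suc m / fact (Suc m))"
      by (simp add: divide_simps)
    then have "q k * (q k ^ m / fact m * R) = real (Suc m) * (q k ^ Suc m / fact (Suc m) * R)"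
      by (simp only: mult.assoc[symmetric])
    then show ?thesis by (simp only: 1 2) (simp only: m)
  qed
  have sum_upd: "(\<Sum>j\<in>J. (c(k := c k - 1)) j) = (\<Sum>j\<in>J. c j) - 1" if "k \<in> J" "c k > 0" for k
  proof -
    have "(\<Sum>j\<in>J - {k}. (c(k := c k - 1)) j) = (\<Sum>j\<in>J - {k}. c j)" by (intro sum.cong) auto
    then show ?thesis using assms that by (simp add: sum.remove[of J k] del: fun_upd_apply) simp
  qed
  have "(\<Sum>f\<in>{..<Suc n} \<rightarrow>\<^sub>E J. of_bool (F (Suc n) c f) * (\<Prod>i<Suc n. q (f i)))
      = (\<Sum>(k, g)\<in>J \<times> ({..<n} \<rightarrow>\<^sub>E J). of_bool (F (Suc n) c (g(n := k))) * (\<Prod>i<Suc n. q ((g(n := k)) i)))"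
    unfolding lessThan_Suc PiE_insert_eq
    using inj_combinator[of n "{..<n}" "\<lambda>_. J"]
    by (subst sum.reindex) (auto simp: comp_def split_def)
  also have "\<dots> = (\<Sum>k\<in>J. \<Sum>g\<in>{..<n} \<rightarrow>\<^sub>E J. of_bool (c k > 0 \<and> F n (c(k := c k - 1)) g) * (q k * (\<Prod>i<n. q (g i))))"
    unfolding sum.cartesian_product[symmetric]
  proof (intro sum.cong refl)
    fix k g assume "k \<in> J" "g \<in> {..<n} \<rightarrow>\<^sub>E J"
    have "(\<Prod>i<n. q ((g(n := k)) i)) = (\<Prod>i<n. q (g i))" by (intro prod.cong) auto
    then have "(\<Prod>i<Suc n. q ((g(n := k)) i)) = q k * (\<Prod>i<n. q (g i))"
      by (simp add: mult.commute del: fun_upd_apply) simp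
    then show "of_bool (F (Suc n) c (g(n := k))) * (\<Prod>i<Suc n. q ((g(n := k)) i))
        = of_bool (c k > 0 \<and> F n (c(k := c k - 1)) g) * (q k * (\<Prod>i<n. q (g i)))"
      by (simp only: F_Suc[OF \<open>k \<in> J\<close>])
  qed
  also have "\<dots> = (\<Sum>k\<in>J. if c k > 0 then q k * (\<Sum>g\<in>{..<n} \<rightarrow>\<^sub>E J. of_bool (F n (c(k := c k - 1)) g) * (\<Prod>i<n. q (g i))) else 0)"
    by (intro sum.cong refl) (auto simp: sum_distrib_left mult_ac)
  also have "\<dots> = (\<Sum>k\<in>J. if c k > 0 \<and> (\<Sum>j\<in>J. c j) - 1 = n then fact n * (real (c k) * V c) else 0)"
  proof (intro sum.cong refl)
    fix k assume k: "k \<in> J"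
    have IH: "(\<Sum>g\<in>{..<n} \<rightarrow>\<^sub>E J. of_bool (F n c' g) * (\<Prod>i<n. q (g i)))
        = (if (\<Sum>j\<in>J. c' j) = n then fact n * V c' else 0)" for c'
      using Suc.IH[of c'] unfolding F_def V_def .
    show "(if c k > 0 then q k * (\<Sum>g\<in>{..<n} \<rightarrow>\<^sub>E J. of_bool (F n (c(k := c k - 1)) g) * (\<Prod>i<n. q (g i))) else 0)
        = (if c k > 0 \<and> (\<Sum>j\<in>J. c j) - 1 = n then fact n * (real (c k) * V c) else 0)"
    proof (cases "c k > 0")
      case True
      show ?thesis
        unfolding IH sum_upd[OF k True] V_upd[OF k True, symmetric] using True by (simp add: mult_ac)
    qed simp
  qed
  also have "\<dots> = (if (\<Sum>j\<in>J. c j) = Suc n then fact (Suc n) * V c else 0)"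
  proof (cases "(\<Sum>j\<in>J. c j) = Suc n")
    case True
    then have "(\<Sum>k\<in>J. if c k > 0 \<and> (\<Sum>j\<in>J. c j) - 1 = n then fact n * (real (c k) * V c) else 0)
       = (\<Sum>k\<in>J. real (c k)) * (fact n * V c)"
      unfolding sum_distrib_right by (intro sum.cong) auto
    also have "(\<Sum>k\<in>J. real (c k)) = real (Suc n)"
      unfolding True[symmetric] by simp
    finally show ?thesis using True by (simp add: mult_ac)
  next
    case False
    \<comment> \<open>Truncation again: for \<open>n = 0\<close> the second condition also holds
      when all counts vanish, and \<open>c k > 0\<close> rules that out.\<close>
    have "\<not> (c k > 0 \<and> (\<Sum>j\<in>J. c j) - 1 = n)" if "k \<in> J" for k
    proof
      assume *: "c k > 0 \<and> (\<Sum>j\<in>J. c j) - 1 = n"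
      then have "(\<Sum>j\<in>J. c j) > 0" using assms that by (meson sum_pos2 zero_le)
      then show False using * False by linarith
    qed
    then have "(\<Sum>k\<in>J. if c k > 0 \<and> (\<Sum>j\<in>J. c j) - 1 = n then fact n * (real (c k) * V c) else 0) = 0"
      by (intro sum.neutral ballI if_not_P)
    then show ?thesis using False by simp
  qed
  finally show ?case unfolding F_def V_def .
qed

text \<open>A whole infinite sequence, so that the sample space does not depend on how many of its
  terms are later used as points.\<close>

definition iid_points :: "real measure \<Rightarrow> (nat \<Rightarrow> real) measure" where
  "iid_points \<mu> = PiM UNIV (\<lambda>_. \<mu>)"

lemma prob_space_iid_points: "prob_space \<mu> \<Longrightarrow> prob_space (iid_points \<mu>)"
  unfolding iid_points_def by (intro prob_space_PiM)

lemma measurable_iid_count: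
  assumes "sets \<mu> = sets borel" "A \<in> sets borel"
  shows "(\<lambda>u. card {i. i < n \<and> u i \<in> A}) \<in> iid_points \<mu> \<rightarrow>\<^sub>M count_space UNIV"
proof -
  have A: "A \<in> sets \<mu>" using assms by simp
  have "card {i. i < n \<and> u i \<in> A} = (\<Sum>i<n. if u i \<in> A then 1 else 0)" for u :: "nat \<Rightarrow> real"
    by (simp add: sum.If_cases Int_def)
  moreover have "(\<lambda>u. \<Sum>i<n. if u i \<in> A then 1 else 0 :: nat) \<in> iid_points \<mu> \<rightarrow>\<^sub>M count_space UNIV"
    unfolding iid_points_def using A by measurable
  ultimately show ?thesis by simp
qed

lemma measure_iid_box:
  assumes "prob_space \<mu>" "\<And>i. i < n \<Longrightarrow> A i \<in> sets \<mu>"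
  shows "\<P>(u in iid_points \<mu>. \<forall>i<n. u i \<in> A i) = (\<Prod>i<n. measure \<mu> (A i))"
proof -
  interpret prob_space \<mu> by fact
  interpret product_prob_space "\<lambda>_. \<mu>" "UNIV :: nat set" ..
  have "measure (PiM UNIV (\<lambda>_. \<mu>)) (emb UNIV {..<n} (PiE {..<n} A)) = (\<Prod>i<n. measure \<mu> (A i))"
    using assms by (intro measure_PiM_emb) auto
  moreover have "emb UNIV {..<n} (PiE {..<n} A) = {u \<in> space (PiM UNIV (\<lambda>_. \<mu>)). \<forall>i<n. u i \<in> A i}"
    by (auto simp: prod_emb_def space_PiM Pi_iff)
  ultimately show ?thesis unfolding iid_points_def by simp
qed

text \<open>The first \<open>n\<close> points are assigned to their classes by a function
  \<open>f\<close>. Samples with a given \<open>f\<close> form a box, different \<open>f\<close>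
  give disjoint boxes, and the box probabilities are summed over all \<open>f\<close> with fibre
  sizes \<open>c\<close>.\<close>

lemma measure_iid_counts:
  assumes "prob_space \<mu>" "sets \<mu> = sets borel" "finite J" "disjoint_family_on A J"
    "\<And>j. j \<in> J \<Longrightarrow> A j \<in> sets borel" "(\<Union>j\<in>J. A j) = UNIV"
  shows "\<P>(u in iid_points \<mu>. \<forall>j\<in>J. card {i. i < n \<and> u i \<in> A j} = c j)
       = (if (\<Sum>j\<in>J. c j) = n then fact n * (\<Prod>j\<in>J. measure \<mu> (A j) ^ c j / fact (c j)) else 0)"
proof -
  interpret U: prob_space "iid_points \<mu>" using assms(1) by (rule prob_space_iid_points)
  define G where "G = {f \<in> {..<n} \<rightarrow>\<^sub>E J. \<forall>j\<in>J. card {i. i < n \<and> f i = j} = c j}"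
  define B where "B f = {u \<in> space (iid_points \<mu>). \<forall>i<n. u i \<in> A (f i)}" for f
  have finG: "finite G"
    unfolding G_def using assms(3) by (intro finite_subset[OF _ finite_PiE[of "{..<n}" "\<lambda>_. J"]]) auto
  have cell: "x \<in> A j \<Longrightarrow> x \<in> A k \<Longrightarrow> j \<in> J \<Longrightarrow> k \<in> J \<Longrightarrow> j = k" for x j k
    using assms(4) by (auto simp: disjoint_family_on_def)
  have "{u \<in> space (iid_points \<mu>). \<forall>j\<in>J. card {i. i < n \<and> u i \<in> A j} = c j} = (\<Union>f\<in>G. B f)"
  proof (intro equalityI subsetI)
    fix u assume u: "u \<in> {u \<in> space (iid_points \<mu>). \<forall>j\<in>J. card {i. i < n \<and> u i \<in> A j} = c j}"
    have "\<exists>j\<in>J. x \<in> A j" for x using assms(6) by blast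
    then obtain k where k: "\<And>x. k x \<in> J \<and> x \<in> A (k x)" by metis
    define f where "f = (\<lambda>i\<in>{..<n}. k (u i))"
    have "{i. i < n \<and> f i = j} = {i. i < n \<and> u i \<in> A j}" if "j \<in> J" for j
      using k cell that by (auto simp: f_def)
    then have "f \<in> G" using k u by (auto simp: G_def f_def)
    moreover have "u \<in> B f" using u k by (auto simp: B_def f_def)
    ultimately show "u \<in> (\<Union>f\<in>G. B f)" by blast
  next
    fix u assume "u \<in> (\<Union>f\<in>G. B f)"
    then obtain f where f: "f \<in> G" "u \<in> B f" by blast
    have "{i. i < n \<and> f i = j} = {i. i < n \<and> u i \<in> A j}" if "j \<in> J" for j
    proof -
      have "f i \<in> J" "u i \<in> A (f i)" if "i < n" for i
        using f that by (auto simp: G_def B_def)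
      then show ?thesis using cell \<open>j \<in> J\<close> by blast
    qed
    then show "u \<in> {u \<in> space (iid_points \<mu>). \<forall>j\<in>J. card {i. i < n \<and> u i \<in> A j} = c j}"
      using f by (auto simp: G_def B_def)
  qed
  moreover have "measure (iid_points \<mu>) (\<Union>f\<in>G. B f) = (\<Sum>f\<in>G. measure (iid_points \<mu>) (B f))"
  proof (rule U.finite_measure_finite_Union[OF finG])
    show "B ` G \<subseteq> sets (iid_points \<mu>)"
    proof (rule image_subsetI)
      fix f assume f: "f \<in> G"
      have A: "A (f i) \<in> sets \<mu>" if "i < n" for i
        using f that assms(2,5) by (auto simp: G_def)
      have *: "{u \<in> space (iid_points \<mu>). u i \<in> A (f i)} \<in> sets (iid_points \<mu>)" if "i < n" for i
      proof -
        have "{u \<in> space (iid_points \<mu>). u i \<in> A (f i)} = (\<lambda>u. u i) -` A (f i) \<inter> space (iid_points \<mu>)"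
          by auto
        also have "\<dots> \<in> sets (iid_points \<mu>)"
          unfolding iid_points_def using A[OF that]
          by (intro measurable_sets[OF measurable_component_singleton]) auto
        finally show ?thesis .
      qed
      have "{u \<in> space (iid_points \<mu>). \<forall>i\<in>{..<n}. u i \<in> A (f i)} \<in> sets (iid_points \<mu>)"
        using * by (intro sets.sets_Collect_finite_All) auto
      also have "{u \<in> space (iid_points \<mu>). \<forall>i\<in>{..<n}. u i \<in> A (f i)} = B f"
        unfolding B_def by blast
      finally show "B f \<in> sets (iid_points \<mu>)" .
    qed
    show "disjoint_family_on B G"
    proof (unfold disjoint_family_on_def, safe, goal_cases)
      case (1 f g u)
      have "f i \<in> J" "g i \<in> J" "u i \<in> A (f i)" "u i \<in> A (g i)" if "i < n" for i
        using 1 that by (auto simp: G_def B_def)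
      then have "f i = g i" if "i < n" for i using that cell by blast
      moreover have "f \<in> {..<n} \<rightarrow>\<^sub>E J" "g \<in> {..<n} \<rightarrow>\<^sub>E J" using 1 unfolding G_def by blast+
      ultimately have "f = g" by (intro PiE_ext) auto
      then show ?case using 1 by simp
    qed
  qed
  moreover have "measure (iid_points \<mu>) (B f) = (\<Prod>i<n. measure \<mu> (A (f i)))" if "f \<in> G" for f
    unfolding B_def using assms(1,2,5) that by (intro measure_iid_box) (auto simp: G_def dest!: PiE_mem)
  moreover have "(\<Sum>f\<in>G. \<Prod>i<n. measure \<mu> (A (f i)))
      = (\<Sum>f\<in>{..<n} \<rightarrow>\<^sub>E J. of_bool (\<forall>j\<in>J. card {i. i < n \<and> f i = j} = c j) * (\<Prod>i<n. measure \<mu> (A (f i))))"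
    unfolding G_def using assms(3)
    by (intro sum.mono_neutral_cong_left) (auto intro: finite_PiE)
  ultimately show ?thesis
    using sum_prod_functions_with_counts[OF assms(3), of n c "\<lambda>j. measure \<mu> (A j)"] by simp
qed

text \<open>Unlike \<^const>\<open>poisson_pmf\<close> this allows the parameter zero.\<close>

definition poisson0_pmf :: "real \<Rightarrow> nat pmf" where
  "poisson0_pmf l = (if l = 0 then return_pmf 0 else poisson_pmf l)"

lemma pmf_poisson0: "l \<ge> 0 \<Longrightarrow> pmf (poisson0_pmf l) k = l ^ k / fact k * exp (- l)"
  by (auto simp: poisson0_pmf_def indicator_def)

definition poisson_points :: "real \<Rightarrow> real measure \<Rightarrow> (nat \<times> (nat \<Rightarrow> real)) measure" where
  "poisson_points l \<mu> = measure_pmf (poisson_pmf l) \<Otimes>\<^sub>M iid_points \<mu>"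

definition points_count :: "real set \<Rightarrow> nat \<times> (nat \<Rightarrow> real) \<Rightarrow> nat" where
  "points_count A = (\<lambda>(n, u). card {i. i < n \<and> u i \<in> A})"

lemma prob_space_poisson_points:
  assumes "prob_space \<mu>"
  shows "prob_space (poisson_points l \<mu>)"
proof -
  interpret U: prob_space "iid_points \<mu>" using assms by (rule prob_space_iid_points)
  interpret pair_prob_space "measure_pmf (poisson_pmf l)" "iid_points \<mu>" ..
  show ?thesis unfolding poisson_points_def by (rule P.prob_space_axioms)
qed

text \<open>The number of points is a discrete variable, so measurability can be checked section by
  section.\<close>

lemma measurable_poisson_points:
  assumes "\<And>n. (\<lambda>u. f (n, u)) \<in> iid_points \<mu> \<rightarrow>\<^sub>M N"
  shows "f \<in> poisson_points l \<mu> \<rightarrow>\<^sub>M N"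
proof -
  have "f \<in> count_space UNIV \<Otimes>\<^sub>M iid_points \<mu> \<rightarrow>\<^sub>M N"
    using assms by (intro measurable_pair_measure_countable1) auto
  moreover have "sets (poisson_points l \<mu>) = sets (count_space UNIV \<Otimes>\<^sub>M iid_points \<mu>)"
    unfolding poisson_points_def by (intro sets_pair_measure_cong) auto
  ultimately show ?thesis using measurable_cong_sets by blast
qed

lemma measurable_points_count:
  assumes "sets \<mu> = sets borel" "A \<in> sets borel"
  shows "points_count A \<in> poisson_points l \<mu> \<rightarrow>\<^sub>M count_space UNIV"
  by (rule measurable_poisson_points) (simp add: points_count_def measurable_iid_count assms)

text \<open>Poisson splitting. Counts over a partition fix the number of points as their sum
  \<open>s\<close>, so the event is a rectangle. The factor \<open>fact s\<close> of the multinomial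
  probability cancels the one in the Poisson weight, and \<open>exp (- l)\<close> factors because
  the class probabilities add up to 1.\<close>

lemma measure_poisson_points_counts:
  assumes "prob_space \<mu>" "sets \<mu> = sets borel" "l > 0" "finite J" "disjoint_family_on A J"
    "\<And>j. j \<in> J \<Longrightarrow> A j \<in> sets borel" "(\<Union>j\<in>J. A j) = UNIV"
  shows "\<P>(\<omega> in poisson_points l \<mu>. \<forall>j\<in>J. points_count (A j) \<omega> = c j)
       = (\<Prod>j\<in>J. pmf (poisson0_pmf (l * measure \<mu> (A j))) (c j))"
proof -
  interpret m: prob_space \<mu> by fact
  interpret U: prob_space "iid_points \<mu>" using assms(1) by (rule prob_space_iid_points)
  interpret Q: pair_prob_space "measure_pmf (poisson_pmf l)" "iid_points \<mu>" ..
  define s where "s = (\<Sum>j\<in>J. c j)"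
  let ?E = "\<lambda>n. {u \<in> space (iid_points \<mu>). \<forall>j\<in>J. card {i. i < n \<and> u i \<in> A j} = c j}"
  have total: "(\<Sum>j\<in>J. card {i. i < n \<and> u i \<in> A j}) = n" for n and u :: "nat \<Rightarrow> real"
  proof -
    have "(\<Sum>j\<in>J. card {i. i < n \<and> u i \<in> A j}) = card (\<Union>j\<in>J. {i. i < n \<and> u i \<in> A j})"
      using assms(4,5) by (subst card_UN_disjoint) (auto simp: disjoint_family_on_def)
    also have "(\<Union>j\<in>J. {i. i < n \<and> u i \<in> A j}) = {..<n}" using assms(7) by blast
    finally show ?thesis by simp
  qed
  have "{\<omega> \<in> space (poisson_points l \<mu>). \<forall>j\<in>J. points_count (A j) \<omega> = c j} = {s} \<times> ?E s"
  proof -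
    have "n = s" if "\<forall>j\<in>J. card {i. i < n \<and> u i \<in> A j} = c j" for n and u :: "nat \<Rightarrow> real"
    proof -
      have "s = (\<Sum>j\<in>J. card {i. i < n \<and> u i \<in> A j})"
        unfolding s_def using that by (intro sum.cong) auto
      then show ?thesis using total by simp
    qed
    then show ?thesis by (auto simp: poisson_points_def space_pair_measure points_count_def)
  qed
  moreover have "?E s \<in> sets (iid_points \<mu>)"
  proof -
    have "{u \<in> space (iid_points \<mu>). card {i. i < s \<and> u i \<in> A j} = c j} \<in> sets (iid_points \<mu>)" if "j \<in> J" for j
    proof -
      have "{u \<in> space (iid_points \<mu>). card {i. i < s \<and> u i \<in> A j} = c j}
          = (\<lambda>u. card {i. i < s \<and> u i \<in> A j}) -` {c j} \<inter> space (iid_points \<mu>)"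
        by auto
      also have "\<dots> \<in> sets (iid_points \<mu>)"
        using assms(2,6) that by (intro measurable_sets[OF measurable_iid_count]) auto
      finally show ?thesis .
    qed
    then show ?thesis using assms(4) by (intro sets.sets_Collect_finite_All)
  qed
  then have "measure (poisson_points l \<mu>) ({s} \<times> ?E s) = pmf (poisson_pmf l) s * measure (iid_points \<mu>) (?E s)"
    unfolding poisson_points_def
    by (simp add: measure_def U.emeasure_pair_measure_Times enn2real_mult emeasure_pmf_single)
  moreover have "measure (iid_points \<mu>) (?E s) = fact s * (\<Prod>j\<in>J. measure \<mu> (A j) ^ c j / fact (c j))"
    using measure_iid_counts[OF assms(1,2,4,5,6,7), of s c] by (simp add: s_def)
  moreover have "(\<Sum>j\<in>J. measure \<mu> (A j)) = 1"
  proof -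
    have sp: "space \<mu> = UNIV" using sets_eq_imp_space_eq[OF assms(2)] by simp
    have "(\<Sum>j\<in>J. measure \<mu> (A j)) = measure \<mu> (\<Union>j\<in>J. A j)"
      using assms by (intro m.finite_measure_finite_Union[symmetric]) auto
    then show ?thesis using assms(7) m.prob_space sp by simp
  qed
  then have "exp (- l) = (\<Prod>j\<in>J. exp (- (l * measure \<mu> (A j))))"
    by (subst exp_sum[OF assms(4), symmetric]) (simp add: sum_negf sum_distrib_left[symmetric])
  then have "pmf (poisson_pmf l) s * (fact s * (\<Prod>j\<in>J. measure \<mu> (A j) ^ c j / fact (c j)))
     = (\<Prod>j\<in>J. pmf (poisson0_pmf (l * measure \<mu> (A j))) (c j))"
    using assms(3)
    by (simp add: pmf_poisson0 prod.distrib s_def power_mult_distrib power_sum[symmetric] prod_dividef)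
  ultimately show ?thesis by simp
qed

text \<open>The sets need not cover the line. The complement of their union is adjoined as class
  \<open>None\<close>, which gives a nonempty partition even for empty \<open>J\<close>; after
  splitting, this class is dropped again.\<close>

lemma
  assumes "prob_space \<mu>" "sets \<mu> = sets borel" "l > 0" "finite J" "disjoint_family_on A J"
    "\<And>j. j \<in> J \<Longrightarrow> A j \<in> sets borel"
  shows indep_vars_points_count:
      "prob_space.indep_vars (poisson_points l \<mu>) (\<lambda>_. count_space UNIV) (\<lambda>j. points_count (A j)) J"
    and distr_points_count:
      "j \<in> J \<Longrightarrow> distr (poisson_points l \<mu>) (count_space UNIV) (points_count (A j))
           = measure_pmf (poisson0_pmf (l * measure \<mu> (A j)))"
proof -
  interpret Q: prob_space "poisson_points l \<mu>" using assms(1) by (rule prob_space_poisson_points)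
  define J' where "J' = insert None (Some ` J)"
  define A' where "A' = case_option (UNIV - (\<Union>j\<in>J. A j)) A"
  have A': "A' j \<in> sets borel" if "j \<in> J'" for j
    using that assms(4,6) unfolding J'_def A'_def by (auto intro!: sets.Diff sets.finite_UN)
  have J': "finite J'" "J' \<noteq> {}" using assms(4) by (auto simp: J'_def)
  have disj: "disjoint_family_on A' J'"
    using assms(5) unfolding J'_def A'_def disjoint_family_on_def by (auto split: option.splits)
  have un: "(\<Union>j\<in>J'. A' j) = UNIV" unfolding J'_def A'_def by auto
  have meas: "points_count (A' j) \<in> poisson_points l \<mu> \<rightarrow>\<^sub>M count_space UNIV" if "j \<in> J'" for j
    using assms(2) A'[OF that] by (rule measurable_points_count)
  note * = Q.indep_vars_countI[OF J' meas measure_poisson_points_counts[OF assms(1,2,3) J'(1) disj A' un]]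
  have "Q.indep_vars (\<lambda>_. count_space UNIV) (\<lambda>j. points_count (A' j)) (Some ` J)"
    by (rule Q.indep_vars_subset[OF *(1)]) (auto simp: J'_def)
  then have "Q.indep_vars (\<lambda>_. count_space UNIV) (\<lambda>j. points_count (A' (Some j))) J"
    by (rule Q.indep_vars_reindex[rotated]) simp
  then show "Q.indep_vars (\<lambda>_. count_space UNIV) (\<lambda>j. points_count (A j)) J"
    by (simp add: A'_def comp_def)
  show "distr (poisson_points l \<mu>) (count_space UNIV) (points_count (A j))
           = measure_pmf (poisson0_pmf (l * measure \<mu> (A j)))" if "j \<in> J"
    using *(2)[of "Some j"] that by (simp add: J'_def A'_def)
qed

section \<open>Occupied cells\<close>

text \<open>For \<open>A\<close> inside \<open>K\<close>: the point mass at \<open>A\<close> of the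
  Bernoulli product law on subsets of \<open>K\<close>.\<close>

definition occupancy_prob :: "('j \<Rightarrow> real) \<Rightarrow> 'j set \<Rightarrow> 'j set \<Rightarrow> real" where
  "occupancy_prob a K A = (\<Prod>j\<in>K. if j \<in> A then a j else 1 - a j)"

lemma sum_Pow_insert:
  assumes "finite K" "x \<notin> K"
  shows "(\<Sum>A\<in>Pow (insert x K). F A) = (\<Sum>A\<in>Pow K. F A + (F (insert x A) :: real))"
proof -
  have "inj_on (insert x) (Pow K)" using assms(2) by (auto simp: inj_on_def)
  moreover have "Pow K \<inter> insert x ` Pow K = {}" using assms(2) by blast
  ultimately show ?thesis
    using assms(1) by (simp add: Pow_insert sum.union_disjoint sum.reindex sum.distrib)
qed

lemma occupancy_prob_insert:
  assumes "finite K" "x \<notin> K" "A \<subseteq> K"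
  shows "occupancy_prob a (insert x K) A = (1 - a x) * occupancy_prob a K A"
    and "occupancy_prob a (insert x K) (insert x A) = a x * occupancy_prob a K A"
proof -
  have "x \<notin> A" using assms by blast
  then show "occupancy_prob a (insert x K) A = (1 - a x) * occupancy_prob a K A"
    using assms by (simp add: occupancy_prob_def)
  have "(\<Prod>j\<in>K. if j \<in> insert x A then a j else 1 - a j) = (\<Prod>j\<in>K. if j \<in> A then a j else 1 - a j)"
    using assms(2) by (intro prod.cong) auto
  then show "occupancy_prob a (insert x K) (insert x A) = a x * occupancy_prob a K A"
    using assms(1,2) by (simp add: occupancy_prob_def)
qed

lemma sum_occupancy_prob:
  assumes "finite K"
  shows "(\<Sum>A\<in>Pow K. occupancy_prob a K A) = 1"
  using assms
proof (induction K rule: finite_induct)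
  case empty
  show ?case by (simp add: occupancy_prob_def)
next
  case (insert x K)
  have "(\<Sum>A\<in>Pow (insert x K). occupancy_prob a (insert x K) A) = (\<Sum>A\<in>Pow K. occupancy_prob a K A)"
    unfolding sum_Pow_insert[OF insert(1,2)]
    using insert(1,2) by (intro sum.cong refl) (auto simp: occupancy_prob_insert algebra_simps)
  then show ?case using insert.IH by simp
qed

lemma occupancy_prob_nonneg:
  "(\<And>j. j \<in> K \<Longrightarrow> a j \<in> {0..1}) \<Longrightarrow> occupancy_prob a K A \<ge> 0"
  unfolding occupancy_prob_def by (intro prod_nonneg) auto

text \<open>An L1 comparison of product laws: the factors are exchanged one at a time, and
  exchanging factor \<open>j\<close> costs the L1 distance \<open>2 * \<bar>a j - b j\<bar>\<close>
  of two Bernoulli laws.\<close>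

lemma sum_occupancy_prob_diff:
  assumes "finite K" "\<And>j. j \<in> K \<Longrightarrow> a j \<in> {0..1::real}" "\<And>j. j \<in> K \<Longrightarrow> b j \<in> {0..1::real}"
  shows "(\<Sum>A\<in>Pow K. \<bar>occupancy_prob a K A - occupancy_prob b K A\<bar>) \<le> 2 * (\<Sum>j\<in>K. \<bar>a j - b j\<bar>)"
  using assms
proof (induction K rule: finite_induct)
  case empty
  show ?case by (simp add: occupancy_prob_def)
next
  case (insert x K)
  have ab: "a x \<in> {0..1}" "b x \<in> {0..1}" using insert.prems by auto
  \<comment> \<open>Here \<open>oa\<close> and \<open>ob\<close> stand for the two weights of one
    subset of \<open>K\<close>; the left side adds its contributions without and with the new
    element \<open>x\<close>.\<close>
  have "\<bar>(1 - a x) * oa - (1 - b x) * ob\<bar> + \<bar>a x * oa - b x * ob\<bar> \<le> \<bar>oa - ob\<bar> + ob * (2 * \<bar>a x - b x\<bar>)"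
    if ob: "ob \<ge> 0" for oa ob
  proof -
    have e: "(1 - a x) * oa - (1 - b x) * ob = (1 - a x) * (oa - ob) + ob * (b x - a x)"
      "a x * oa - b x * ob = a x * (oa - ob) + ob * (a x - b x)"
      by (auto simp: algebra_simps)
    have "\<bar>(1 - a x) * oa - (1 - b x) * ob\<bar> \<le> (1 - a x) * \<bar>oa - ob\<bar> + ob * \<bar>a x - b x\<bar>"
      unfolding e(1) using ab ob
      by (intro order_trans[OF abs_triangle_ineq]) (simp add: abs_mult abs_minus_commute)
    moreover have "\<bar>a x * oa - b x * ob\<bar> \<le> a x * \<bar>oa - ob\<bar> + ob * \<bar>a x - b x\<bar>"
      unfolding e(2) using ab ob
      by (intro order_trans[OF abs_triangle_ineq]) (simp add: abs_mult)
    ultimately show ?thesis by (simp add: algebra_simps)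
  qed
  moreover have "occupancy_prob b K A \<ge> 0" for A
    using insert.prems(2) by (intro occupancy_prob_nonneg) auto
  ultimately have "(\<Sum>A\<in>Pow (insert x K). \<bar>occupancy_prob a (insert x K) A - occupancy_prob b (insert x K) A\<bar>)
     \<le> (\<Sum>A\<in>Pow K. \<bar>occupancy_prob a K A - occupancy_prob b K A\<bar> + occupancy_prob b K A * (2 * \<bar>a x - b x\<bar>))"
    unfolding sum_Pow_insert[OF insert(1,2)]
    using insert(1,2) by (intro sum_mono) (auto simp: occupancy_prob_insert)
  also have "\<dots> = (\<Sum>A\<in>Pow K. \<bar>occupancy_prob a K A - occupancy_prob b K A\<bar>) + 2 * \<bar>a x - b x\<bar>"
    using sum_occupancy_prob[OF insert(1), of b]
    by (simp add: sum.distrib sum_distrib_right[symmetric])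
  also have "\<dots> \<le> 2 * (\<Sum>j\<in>insert x K. \<bar>a j - b j\<bar>)"
    using insert by (simp add: algebra_simps)
  finally show ?case .
qed

lemma sum_weighted_occupancy_diff:
  assumes "finite K" "\<And>j. j \<in> K \<Longrightarrow> a j \<in> {0..1::real}" "\<And>j. j \<in> K \<Longrightarrow> b j \<in> {0..1::real}"
    and g: "\<And>A. A \<subseteq> K \<Longrightarrow> \<bar>g A\<bar> \<le> B"
  shows "\<bar>(\<Sum>A\<in>Pow K. g A * occupancy_prob a K A) - (\<Sum>A\<in>Pow K. g A * occupancy_prob b K A)\<bar>
     \<le> 2 * B * (\<Sum>j\<in>K. \<bar>a j - b j\<bar>)"
proof -
  have B: "B \<ge> 0" using g[of "{}"] by force
  have "\<bar>\<Sum>A\<in>Pow K. g A * (occupancy_prob a K A - occupancy_prob b K A)\<bar>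
     \<le> (\<Sum>A\<in>Pow K. B * \<bar>occupancy_prob a K A - occupancy_prob b K A\<bar>)"
    using g B by (intro order_trans[OF sum_abs] sum_mono) (auto simp: abs_mult intro!: mult_right_mono)
  also have "\<dots> \<le> B * (2 * (\<Sum>j\<in>K. \<bar>a j - b j\<bar>))"
    unfolding sum_distrib_left[symmetric]
    by (intro mult_left_mono sum_occupancy_prob_diff assms B)
  finally show ?thesis by (simp add: sum_subtractf algebra_simps)
qed

lemma (in prob_space) expectation_occupied_set:
  fixes Y :: "'j \<Rightarrow> 'a \<Rightarrow> bool" and g :: "'j set \<Rightarrow> real"
  assumes K: "finite K" "K \<noteq> {}" and Y: "indep_vars (\<lambda>_. count_space UNIV) Y K"
  shows "(\<lambda>\<omega>. g {j \<in> K. Y j \<omega>}) \<in> borel_measurable M"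
    and "expectation (\<lambda>\<omega>. g {j \<in> K. Y j \<omega>})
       = (\<Sum>A\<in>Pow K. g A * occupancy_prob (\<lambda>j. \<P>(\<omega> in M. Y j \<omega>)) K A)"
proof -
  have Ym: "Y j -` S \<inter> space M \<in> events" if "j \<in> K" for j S
    using Y that unfolding indep_vars_def by (intro measurable_sets[of "Y j" M "count_space UNIV"]) auto
  \<comment> \<open>The set \<open>{j \<in> A}\<close> is the singleton of a truth value: the event
    prescribes whether cell \<open>j\<close> is occupied.\<close>
  define E where "E A = (\<Inter>j\<in>K. Y j -` {j \<in> A} \<inter> space M)" for A
  have E: "E A \<in> events" for A
    unfolding E_def using K Ym by (intro sets.finite_INT) auto
  have ES: "\<omega> \<in> E A \<longleftrightarrow> {j \<in> K. Y j \<omega>} = A" if "A \<subseteq> K" "\<omega> \<in> space M" for A \<omega>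
    unfolding E_def using that by auto
  have eq: "g {j \<in> K. Y j \<omega>} = (\<Sum>A\<in>Pow K. g A * indicator (E A) \<omega>)" if "\<omega> \<in> space M" for \<omega>
  proof -
    have "(\<Sum>A\<in>Pow K. g A * indicator (E A) \<omega>) = (\<Sum>A\<in>Pow K. if A = {j \<in> K. Y j \<omega>} then g A else 0)"
      using that by (intro sum.cong refl) (auto simp: ES indicator_def)
    also have "\<dots> = g {j \<in> K. Y j \<omega>}" using K(1) by (subst sum.delta) auto
    finally show ?thesis ..
  qed
  have "(\<lambda>\<omega>. \<Sum>A\<in>Pow K. g A * indicator (E A) \<omega>) \<in> borel_measurable M"
    using E by (intro borel_measurable_sum borel_measurable_times borel_measurable_indicator) auto
  then show "(\<lambda>\<omega>. g {j \<in> K. Y j \<omega>}) \<in> borel_measurable M"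
    by (subst measurable_cong[OF eq])
  have "prob (E A) = occupancy_prob (\<lambda>j. \<P>(\<omega> in M. Y j \<omega>)) K A" for A
  proof -
    have "prob (Y j -` {j \<in> A} \<inter> space M) = (if j \<in> A then \<P>(\<omega> in M. Y j \<omega>) else 1 - \<P>(\<omega> in M. Y j \<omega>))"
      if "j \<in> K" for j
    proof -
      have 1: "Y j -` {True} \<inter> space M = {\<omega> \<in> space M. Y j \<omega>}" by auto
      have "prob (Y j -` {False} \<inter> space M) = prob (space M - Y j -` {True} \<inter> space M)"
        by (intro arg_cong[of _ _ prob]) auto
      also have "\<dots> = 1 - \<P>(\<omega> in M. Y j \<omega>)"
        using prob_compl[OF Ym[OF that, of "{True}"]] unfolding 1 .
      finally show ?thesis using 1 by (cases "j \<in> A") auto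
    qed
    then show ?thesis
      unfolding E_def occupancy_prob_def using K
      by (subst indep_varsD_finite[OF Y]) (auto intro!: prod.cong)
  qed
  then show "expectation (\<lambda>\<omega>. g {j \<in> K. Y j \<omega>})
       = (\<Sum>A\<in>Pow K. g A * occupancy_prob (\<lambda>j. \<P>(\<omega> in M. Y j \<omega>)) K A)"
    using E by (subst Bochner_Integration.integral_cong[OF refl eq])
       (simp_all add: Bochner_Integration.integral_sum less_top[symmetric])
qed

text \<open>The comparison step shared by the Poisson process and the exceedances: off
  \<open>bad\<close> the replacement by occupied cells costs \<open>e\<close>, and on
  \<open>bad\<close> both values are bounded by \<open>B\<close>.\<close>

lemma (in prob_space) expectation_approx_occupied_set:
  fixes Y :: "'j \<Rightarrow> 'a \<Rightarrow> bool" and g :: "'j set \<Rightarrow> real"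
  assumes K: "finite K" "K \<noteq> {}" and Y: "indep_vars (\<lambda>_. count_space UNIV) Y K"
    and f: "f \<in> borel_measurable M" "\<And>\<omega>. \<omega> \<in> space M \<Longrightarrow> \<bar>f \<omega>\<bar> \<le> B"
    and g: "\<And>A. A \<subseteq> K \<Longrightarrow> \<bar>g A\<bar> \<le> B"
    and bad: "bad \<in> events" "\<And>\<omega>. \<omega> \<in> space M \<Longrightarrow> \<omega> \<notin> bad \<Longrightarrow> \<bar>f \<omega> - g {j \<in> K. Y j \<omega>}\<bar> \<le> e"
    and e: "e \<ge> 0"
  shows "\<bar>expectation f - (\<Sum>A\<in>Pow K. g A * occupancy_prob (\<lambda>j. \<P>(\<omega> in M. Y j \<omega>)) K A)\<bar> \<le> e + 2 * B * prob bad"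
proof -
  let ?G = "\<lambda>\<omega>. g {j \<in> K. Y j \<omega>}"
  have B: "B \<ge> 0" using g[of "{}"] by force
  note G = expectation_occupied_set[OF K Y, of g]
  have g': "\<bar>?G \<omega>\<bar> \<le> B" for \<omega> by (rule g) auto
  have int: "integrable M f" "integrable M ?G"
    using f g' G(1) by (auto intro!: integrable_const_bound[where B = B])
  have "\<bar>expectation f - expectation ?G\<bar> = \<bar>expectation (\<lambda>\<omega>. f \<omega> - ?G \<omega>)\<bar>"
    using int by (simp add: Bochner_Integration.integral_diff)
  also have "\<dots> \<le> expectation (\<lambda>\<omega>. \<bar>f \<omega> - ?G \<omega>\<bar>)"
    by (rule integral_abs_bound)
  also have "\<dots> \<le> expectation (\<lambda>\<omega>. e + 2 * B * indicator bad \<omega>)"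
  proof (rule integral_mono)
    show "integrable M (\<lambda>\<omega>. \<bar>f \<omega> - ?G \<omega>\<bar>)" using int by auto
    show "integrable M (\<lambda>\<omega>. e + 2 * B * indicator bad \<omega>)"
      using bad(1) by (auto simp: less_top[symmetric])
    fix \<omega> assume w: "\<omega> \<in> space M"
    show "\<bar>f \<omega> - ?G \<omega>\<bar> \<le> e + 2 * B * indicator bad \<omega>"
    proof (cases "\<omega> \<in> bad")
      case True
      have "\<bar>f \<omega> - ?G \<omega>\<bar> \<le> B + B" using f(2)[OF w] g'[of \<omega>] by linarith
      then show ?thesis using True e by simp
    next
      case False
      then show ?thesis using bad(2)[OF w False] by simp
    qed
  qed
  also have "\<dots> = e + 2 * B * prob bad"
    using bad(1) by (simp add: less_top[symmetric] prob_space)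
  finally show ?thesis unfolding G(2) .
qed

section \<open>Cells of the interval and discretised configurations\<close>

text \<open>Rounding up numbers the left-open cells from 1 to \<open>k\<close> and leaves only the
  point 0 for cell 0. Exceedance points are positive and a Poisson point hits 0 with probability
  zero, so cell 0 is never charged or has probability zero of being so.\<close>

definition cell :: "real \<Rightarrow> nat \<Rightarrow> real \<Rightarrow> nat" where
  "cell C k x = nat \<lceil>x * real k / C\<rceil>"

definition cell_point :: "real \<Rightarrow> nat \<Rightarrow> nat \<Rightarrow> real" where
  "cell_point C k j = real j * C / real k"

lemma cell_le:
  assumes "C > 0" "k > 0" "x \<in> {0..C}"
  shows "cell C k x \<le> k"
proof -
  have "x * real k \<le> C * real k" using assms by (intro mult_right_mono) auto
  then have "x * real k / C \<le> of_int (int k)" using assms(1) by (simp add: divide_simps mult.commute)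
  then have "\<lceil>x * real k / C\<rceil> \<le> int k" by (rule ceiling_le)
  then show ?thesis unfolding cell_def by (simp only: nat_le_iff)
qed

lemma cell_eq_iff:
  assumes "C > 0" "k > 0" "x \<ge> 0"
  shows "cell C k x = Suc j \<longleftrightarrow> cell_point C k j < x \<and> x \<le> cell_point C k (Suc j)"
    and "cell C k x = 0 \<longleftrightarrow> x = 0"
proof -
  have nn: "0 \<le> \<lceil>x * real k / C\<rceil>"
  proof -
    have "0 \<le> x * real k / C" using assms by simp
    then show ?thesis by linarith
  qed
  then have "cell C k x = Suc j \<longleftrightarrow> \<lceil>x * real k / C\<rceil> = int j + 1"
    unfolding cell_def by auto
  also have "\<dots> \<longleftrightarrow> real j < x * real k / C \<and> x * real k / C \<le> real j + 1"
    by (auto simp: ceiling_eq_iff)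
  also have "\<dots> \<longleftrightarrow> cell_point C k j < x \<and> x \<le> cell_point C k (Suc j)"
    using assms(1,2) by (simp add: cell_point_def field_simps)
  finally show "cell C k x = Suc j \<longleftrightarrow> cell_point C k j < x \<and> x \<le> cell_point C k (Suc j)" .
  show "cell C k x = 0 \<longleftrightarrow> x = 0"
    using assms by (auto simp: cell_def ceiling_le_iff divide_simps mult_le_0_iff)
qed

lemma cell_point_in:
  assumes "C > 0" "k > 0" "j \<le> k"
  shows "cell_point C k j \<in> {0..C}"
  using assms by (simp add: cell_point_def divide_simps mult.commute mult_right_mono)

lemma cell_point_dist:
  assumes "C > 0" "k > 0" "x \<in> {0..C}"
  shows "\<bar>x - cell_point C k (cell C k x)\<bar> \<le> C / real k"
proof (cases "cell C k x")
  case 0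
  then show ?thesis using cell_eq_iff(2)[of C k x] assms by (simp add: cell_point_def)
next
  case (Suc j)
  have "cell_point C k (Suc j) = cell_point C k j + C / real k"
    by (simp add: cell_point_def add_divide_distrib algebra_simps)
  then show ?thesis using cell_eq_iff(1)[of C k x j] assms Suc by auto
qed

text \<open>Every point moves to the right end of its cell, by at most \<open>C / real k\<close>. A
  set of cells carries no multiplicities, so it can represent the configuration only if no two
  points share a cell.\<close>

lemma discretise_atoms_measure:
  assumes C: "C > 0" "k > 0"
    and h: "atoms_modulus C h L e d"
    and k: "C / real k < d"
    and J: "finite J" "card J \<le> L" "y \<in> J \<rightarrow> {0..C}" "inj_on (\<lambda>i. cell C k (y i)) J"
  shows "\<bar>h (atoms_measure C J y) - h (atoms_measure C ((\<lambda>i. cell C k (y i)) ` J) (cell_point C k))\<bar> < e"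
proof -
  let ?c = "\<lambda>i. cell C k (y i)"
  have c: "?c i \<le> k" if "i \<in> J" for i using that C J(3) by (intro cell_le) auto
  have "atoms_measure C (?c ` J) (cell_point C k) = atoms_measure C J (\<lambda>i. cell_point C k (?c i))"
    using J(4) cell_point_in[OF C] c by (intro atoms_measure_reindex) (auto simp: bij_betw_def)
  moreover have "\<bar>h (atoms_measure C J y) - h (atoms_measure C J (\<lambda>i. cell_point C k (?c i)))\<bar> < e"
  proof (rule atoms_modulusD[OF h J(1-3)])
    show "(\<lambda>i. cell_point C k (?c i)) \<in> J \<rightarrow> {0..C}" using cell_point_in[OF C] c by blast
    show "\<bar>y i - cell_point C k (?c i)\<bar> < d" if "i \<in> J" for i
      using cell_point_dist[OF C, of "y i"] that J(3) k by (auto simp: Pi_iff)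
  qed
  ultimately show ?thesis by simp
qed

section \<open>Construction and discretisation of the Poisson process\<close>

definition uniform_Icc :: "real \<Rightarrow> real measure" where
  "uniform_Icc C = uniform_measure lborel {0..C}"

lemma sets_uniform_Icc [simp]: "sets (uniform_Icc C) = sets borel"
  by (simp add: uniform_Icc_def)

lemma prob_space_uniform_Icc: "C > 0 \<Longrightarrow> prob_space (uniform_Icc C)"
  unfolding uniform_Icc_def by (intro prob_space_uniform_measure) auto

lemma borel_measurable_clamp_Icc [measurable]: "clamp_Icc C \<in> borel_measurable borel"
  unfolding clamp_Icc_def by measurable

lemma vimage_clamp_borel: "A \<in> sets borel \<Longrightarrow> clamp_Icc C -` A \<in> sets borel"
  using measurable_sets[OF borel_measurable_clamp_Icc, of A C] by simp

lemma measure_uniform_Icc_clamp: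
  assumes "C > 0" "A \<in> sets borel" "A \<subseteq> {0..C}"
  shows "measure (uniform_Icc C) (clamp_Icc C -` A) = measure lborel A / C"
proof -
  \<comment> \<open>If \<open>A\<close> contains an end point, the preimage also contains a
    half-line outside the interval, which the uniform law ignores.\<close>
  have "{0..C} \<inter> clamp_Icc C -` A = A"
    using assms(3) by (auto simp: clamp_Icc_id)
  moreover have "emeasure lborel A \<noteq> \<infinity>"
    using emeasure_mono[OF assms(3), of lborel] assms by (auto simp: top_unique)
  ultimately show ?thesis
    unfolding uniform_Icc_def using assms vimage_clamp_borel[OF assms(2)]
    by (subst measure_uniform_measure) (auto simp: less_top[symmetric])
qed

definition poisson_measure_map :: "real \<Rightarrow> nat \<times> (nat \<Rightarrow> real) \<Rightarrow> real measure" where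
  "poisson_measure_map C = (\<lambda>(n, u). atoms_measure C {..<n} (\<lambda>i. clamp_Icc C (u i)))"

text \<open>For a fixed number of points the map is continuous in the positions, and the product
  sigma-algebra on sequences coincides with the Borel one.\<close>

lemma measurable_poisson_measure_map:
  assumes "C > 0" "sets \<mu> = sets borel"
  shows "poisson_measure_map C \<in> poisson_points l \<mu> \<rightarrow>\<^sub>M borel_of (counting_topology C)"
proof (rule measurable_poisson_points)
  fix n
  have sp: "space (iid_points \<mu>) = UNIV"
    using sets_eq_imp_space_eq[OF assms(2)] by (simp add: iid_points_def space_PiM)
  have sets: "sets (iid_points \<mu>) = sets (borel :: (nat \<Rightarrow> real) measure)"
    unfolding iid_points_def sets_PiM_equal_borel[symmetric]
    using assms(2) by (intro sets_PiM_cong) auto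
  have cont: "continuous_map euclidean (counting_topology C) (\<lambda>u. poisson_measure_map C (n, u))"
    unfolding poisson_measure_map_def using continuous_map_atoms_measure[OF assms(1)] by simp
  show "(\<lambda>u. poisson_measure_map C (n, u)) \<in> iid_points \<mu> \<rightarrow>\<^sub>M borel_of (counting_topology C)"
  proof (rule measurable_borel_ofI)
    show "(\<lambda>u. poisson_measure_map C (n, u)) \<in> space (iid_points \<mu>) \<rightarrow> topspace (counting_topology C)"
      using continuous_map_image_subset_topspace[OF cont] by auto
    fix U assume "openin (counting_topology C) U"
    then have "open ((\<lambda>u. poisson_measure_map C (n, u)) -` U)"
      using openin_continuous_map_preimage[OF cont] by (simp add: vimage_def)
    then show "(\<lambda>u. poisson_measure_map C (n, u)) -` U \<inter> space (iid_points \<mu>) \<in> sets (iid_points \<mu>)"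
      by (simp add: sp sets)
  qed
qed

lemma measure_poisson_measure_map:
  assumes "C > 0" "A \<in> sets borel" "A \<subseteq> {0..C}"
  shows "measure (poisson_measure_map C \<omega>) A = real (points_count (clamp_Icc C -` A) \<omega>)"
proof -
  obtain n u where \<omega>: "\<omega> = (n, u)" by (cases \<omega>)
  have "(\<lambda>i. clamp_Icc C (u i)) \<in> {..<n} \<rightarrow> {0..C}"
    using clamp_Icc_in[OF assms(1)] by blast
  then show ?thesis
    unfolding \<omega> poisson_measure_map_def points_count_def
    using assms by (simp add: measure_atoms_measure vimage_def)
qed

text \<open>Points in \<open>A\<close> are counted as coordinates in the clamped preimage of
  \<open>A\<close>, whose uniform probability is the length of \<open>A\<close> over
  \<open>C\<close>. Splitting with total mean \<open>\<beta> * C\<close> then gives mean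
  \<open>\<beta>\<close> times the length.\<close>

lemma poisson_process_law_distr:
  assumes "C > 0" "\<beta> > 0"
  shows "poisson_process_law C \<beta>
     (distr (poisson_points (\<beta> * C) (uniform_Icc C)) (borel_of (counting_topology C)) (poisson_measure_map C))"
    (is "poisson_process_law C \<beta> (distr ?Q ?T ?\<Phi>)")
proof -
  interpret U: prob_space "uniform_Icc C" using assms(1) by (rule prob_space_uniform_Icc)
  interpret Q: prob_space ?Q by (rule prob_space_poisson_points[OF U.prob_space_axioms])
  have \<Phi>: "?\<Phi> \<in> ?Q \<rightarrow>\<^sub>M ?T"
    using assms(1) by (intro measurable_poisson_measure_map) auto
  have bC: "\<beta> * C > 0" using assms by simp
  have rv: "(\<lambda>\<mu>. measure \<mu> A) \<in> borel_measurable ?T" if "A \<in> sets borel" "A \<subseteq> {0..C}" for A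
    using measurable_measure_counting[OF that(1), of C] that(2) by (simp add: Int_absorb2)
  show ?thesis
    unfolding poisson_process_law_def
  proof (intro conjI allI impI)
    show "prob_space (distr ?Q ?T ?\<Phi>)" using \<Phi> by (rule Q.prob_space_distr)
    show "sets (distr ?Q ?T ?\<Phi>) = sets ?T" by simp
  next
    fix A n assume A: "A \<in> sets borel" "A \<subseteq> {0..C}"
    let ?A = "clamp_Icc C -` A"
    have cnt: "points_count ?A \<in> ?Q \<rightarrow>\<^sub>M count_space UNIV"
      using vimage_clamp_borel[OF A(1)] by (intro measurable_points_count) auto
    have "{\<mu> \<in> space ?T. measure \<mu> A = real n} \<in> sets ?T"
      using rv[OF A] by measurable
    then have "\<P>(\<mu> in distr ?Q ?T ?\<Phi>. measure \<mu> A = real n)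
       = measure ?Q (?\<Phi> -` {\<mu> \<in> space ?T. measure \<mu> A = real n} \<inter> space ?Q)"
      using \<Phi> by (subst measure_distr) auto
    also have "?\<Phi> -` {\<mu> \<in> space ?T. measure \<mu> A = real n} \<inter> space ?Q = points_count ?A -` {n} \<inter> space ?Q"
      using measurable_space[OF \<Phi>] by (auto simp: measure_poisson_measure_map[OF assms(1) A])
    also have "measure ?Q \<dots> = measure (distr ?Q (count_space UNIV) (points_count ?A)) {n}"
      using cnt by (subst measure_distr) auto
    also have "distr ?Q (count_space UNIV) (points_count ?A)
        = measure_pmf (poisson0_pmf (\<beta> * C * measure (uniform_Icc C) ?A))"
      \<comment> \<open>A family with the single index \<open>()\<close> yields the law of one
        count.\<close>
      using distr_points_count[OF U.prob_space_axioms _ bC, of "{()}" "\<lambda>_. ?A" "()"] vimage_clamp_borel[OF A(1)]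
      by (simp add: disjoint_family_on_def)
    also have "\<beta> * C * measure (uniform_Icc C) ?A = \<beta> * measure lborel A"
      using measure_uniform_Icc_clamp[OF assms(1) A] assms(1) by simp
    finally show "\<P>(\<mu> in distr ?Q ?T ?\<Phi>. measure \<mu> A = real n)
        = exp (- (\<beta> * measure lborel A)) * (\<beta> * measure lborel A) ^ n / fact n"
      using assms(2) by (simp add: measure_pmf_single pmf_poisson0)
  next
    fix J :: "nat set" and A
    assume J: "finite J" "disjoint_family_on A J" "\<forall>j\<in>J. A j \<in> sets borel \<and> A j \<subseteq> {0..C}"
    have "Q.indep_vars (\<lambda>_. count_space UNIV) (\<lambda>j. points_count (clamp_Icc C -` A j)) J"
      using J by (intro indep_vars_points_count[OF U.prob_space_axioms _ bC])
        (auto simp: disjoint_family_on_def vimage_clamp_borel)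
    then have "Q.indep_vars (\<lambda>_. borel) (\<lambda>j \<omega>. real (points_count (clamp_Icc C -` A j) \<omega>)) J"
      by (rule Q.indep_vars_compose2) auto
    then have "Q.indep_vars (\<lambda>_. borel) (\<lambda>j \<omega>. measure (?\<Phi> \<omega>) (A j)) J"
      by (subst Q.indep_vars_cong[OF refl _ refl]) (use J(3) measure_poisson_measure_map[OF assms(1)] in auto)
    then show "prob_space.indep_vars (distr ?Q ?T ?\<Phi>) (\<lambda>_. borel) (\<lambda>j \<mu>. measure \<mu> (A j)) J"
      using J(3) rv by (subst Q.indep_vars_distr_iff[OF \<Phi>]) auto
  qed
qed

text \<open>The probability is \<open>1 - (1 + l) * exp (- l)\<close>, and
  \<open>exp (- l) \<ge> 1 - l\<close>.\<close>

lemma poisson0_pmf_ge_2: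
  assumes "l \<ge> 0"
  shows "measure_pmf.prob (poisson0_pmf l) {2..} \<le> l\<^sup>2"
proof -
  have "{2..} = UNIV - {0, 1::nat}" by auto
  then have "measure_pmf.prob (poisson0_pmf l) {2..} = 1 - measure_pmf.prob (poisson0_pmf l) {0, 1}"
    using measure_pmf.prob_compl[of "{0, 1}" "poisson0_pmf l"] by simp
  also have "\<dots> = 1 - (1 + l) * exp (- l)"
    using assms by (simp add: measure_measure_pmf_finite pmf_poisson0 algebra_simps)
  finally have "measure_pmf.prob (poisson0_pmf l) {2..} = 1 - (1 + l) * exp (- l)" .
  moreover have "(1 + l) * (1 - l) \<le> (1 + l) * exp (- l)"
    using assms exp_ge_add_one_self[of "- l"] by (intro mult_left_mono) auto
  moreover have "(1 + l) * (1 - l) = 1 - l\<^sup>2" by (simp add: algebra_simps power2_eq_square)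
  ultimately show ?thesis by linarith
qed

definition cell_set :: "real \<Rightarrow> nat \<Rightarrow> nat \<Rightarrow> real set" where
  "cell_set C k j = {x \<in> {0..C}. cell C k x = j}"

lemma cell_set_0: "C > 0 \<Longrightarrow> k > 0 \<Longrightarrow> cell_set C k 0 = {0}"
  by (auto simp: cell_set_def cell_eq_iff(2))

lemma cell_set_Suc:
  assumes "C > 0" "k > 0" "Suc j \<le> k"
  shows "cell_set C k (Suc j) = {cell_point C k j<..cell_point C k (Suc j)}"
  using assms cell_point_in[OF assms(1,2), of j] cell_point_in[OF assms(1,2), of "Suc j"]
  by (auto simp: cell_set_def cell_eq_iff(1))

lemma measure_cell_set:
  assumes "C > 0" "k > 0" "j \<le> k"
  shows "cell_set C k j \<in> sets borel"
    and "measure lborel (cell_set C k j) = (if j = 0 then 0 else C / real k)"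
proof -
  have *: "cell_point C k (Suc i) - cell_point C k i = C / real k" for i
    by (simp add: cell_point_def diff_divide_distrib[symmetric] algebra_simps)
  have "cell_point C k i \<le> cell_point C k (Suc i)" for i
    using * assms by (metis diff_ge_0_iff_ge divide_nonneg_nonneg less_eq_real_def of_nat_0_le_iff)
  then show "cell_set C k j \<in> sets borel"
    and "measure lborel (cell_set C k j) = (if j = 0 then 0 else C / real k)"
    using assms * by (cases j; simp add: cell_set_0 cell_set_Suc)+
qed

text \<open>With \<open>l\<close> the mean total count, cells 1 to \<open>k\<close> have Poisson
  mean \<open>l / real k\<close> and are empty with the exponential probability; cell 0 is a null
  set.\<close>

definition poisson_occupancy :: "real \<Rightarrow> nat \<Rightarrow> nat \<Rightarrow> real" where
  "poisson_occupancy l k j = (if j = 0 then 0 else 1 - exp (- (l / real k)))"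

text \<open>The exceptional event is that more than \<open>L\<close> points occur or that two share
  a cell. Each of the \<open>k\<close> cells of positive length contributes at most
  \<open>(\<beta> * C / real k)\<^sup>2\<close> to the latter; otherwise the discretisation costs
  \<open>e\<close>.\<close>

lemma poisson_expectation_approx:
  assumes C: "C > 0" "k > 0" and beta: "\<beta> > 0"
    and h: "h \<in> borel_measurable (borel_of (counting_topology C))"
    and B: "\<And>\<mu>. \<mu> \<in> counting_measures C \<Longrightarrow> \<bar>h \<mu>\<bar> \<le> B"
    and d: "atoms_modulus C h L e d"
    and e: "e > 0" and k: "C / real k < d"
  shows "\<bar>(\<integral>\<omega>. h (poisson_measure_map C \<omega>) \<partial>poisson_points (\<beta> * C) (uniform_Icc C))
      - (\<Sum>A\<in>Pow {..k}. h (atoms_measure C A (cell_point C k)) * occupancy_prob (poisson_occupancy (\<beta> * C) k) {..k} A)\<bar>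
    \<le> e + 2 * B * (measure_pmf.prob (poisson_pmf (\<beta> * C)) {L<..} + (\<beta> * C)\<^sup>2 / real k)"
proof -
  let ?Q = "poisson_points (\<beta> * C) (uniform_Icc C)"
  interpret U: prob_space "uniform_Icc C" using C(1) by (rule prob_space_uniform_Icc)
  interpret Q: prob_space ?Q by (rule prob_space_poisson_points[OF U.prob_space_axioms])
  have bC: "\<beta> * C > 0" using C beta by simp
  define A where "A j = clamp_Icc C -` cell_set C k j" for j
  have A: "A j \<in> sets borel" if "j \<in> {..k}" for j
    unfolding A_def using measure_cell_set(1)[OF C] that by (intro vimage_clamp_borel) auto
  have mA: "\<beta> * C * measure (uniform_Icc C) (A j) = (if j = 0 then 0 else \<beta> * C / real k)" if "j \<in> {..k}" for j
    unfolding A_def using that measure_cell_set[OF C] C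
    by (subst measure_uniform_Icc_clamp) (auto simp: cell_set_def)
  have disj: "disjoint_family_on A {..k}"
    by (auto simp: disjoint_family_on_def A_def cell_set_def)
  have cnt: "points_count S \<in> ?Q \<rightarrow>\<^sub>M count_space UNIV" if "S \<in> sets borel" for S
    using that by (intro measurable_points_count) auto
  define Y where "Y j \<omega> \<longleftrightarrow> points_count (A j) \<omega> > 0" for j \<omega>
  have "Q.indep_vars (\<lambda>_. count_space UNIV) (\<lambda>j. points_count (A j)) {..k}"
    using A disj by (intro indep_vars_points_count[OF U.prob_space_axioms _ bC]) auto
  then have Y: "Q.indep_vars (\<lambda>_. count_space UNIV) Y {..k}"
    unfolding Y_def by (rule Q.indep_vars_compose2) auto
  have law: "measure ?Q (points_count S -` T \<inter> space ?Q)
      = measure_pmf.prob (poisson0_pmf (\<beta> * C * measure (uniform_Icc C) S)) T"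
    if "S \<in> sets borel" for S T
    using distr_points_count[OF U.prob_space_axioms _ bC, of "{()}" "\<lambda>_. S" "()"] that cnt[OF that]
    by (auto simp: disjoint_family_on_def measure_distr[symmetric])
  have probY: "\<P>(\<omega> in ?Q. Y j \<omega>) = poisson_occupancy (\<beta> * C) k j" if "j \<in> {..k}" for j
  proof -
    have "{\<omega> \<in> space ?Q. Y j \<omega>} = points_count (A j) -` (UNIV - {0}) \<inter> space ?Q" by (auto simp: Y_def)
    then have "\<P>(\<omega> in ?Q. Y j \<omega>) = measure_pmf.prob (poisson0_pmf (if j = 0 then 0 else \<beta> * C / real k)) (UNIV - {0})"
      using law[OF A[OF that]] mA[OF that] by simp
    also have "\<dots> = poisson_occupancy (\<beta> * C) k j"
      using measure_pmf.prob_compl[of "{0}" "poisson0_pmf (if j = 0 then 0 else \<beta> * C / real k)"] bC C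
      by (auto simp: measure_pmf_single pmf_poisson0 poisson_occupancy_def)
    finally show ?thesis .
  qed
  define many where "many j = points_count (A j) -` {2..} \<inter> space ?Q" for j
  define large where "large = points_count UNIV -` {L<..} \<inter> space ?Q"
  have ev: "large \<in> Q.events" "many j \<in> Q.events" if "j \<in> {..k}" for j
    unfolding large_def many_def using A that by (auto intro!: measurable_sets[OF cnt])
  have ev_large: "large \<in> Q.events" unfolding large_def by (auto intro!: measurable_sets[OF cnt])
  have "Q.prob (large \<union> (\<Union>j\<in>{..k}. many j)) \<le> Q.prob large + Q.prob (\<Union>j\<in>{..k}. many j)"
    using ev ev_large by (intro measure_Un_le) auto
  also have "Q.prob (\<Union>j\<in>{..k}. many j) \<le> (\<Sum>j\<in>{..k}. Q.prob (many j))"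
    using ev by (intro Q.finite_measure_subadditive_finite) auto
  also have "\<dots> \<le> (\<Sum>j\<in>{..k}. if j = 0 then 0 else (\<beta> * C / real k)\<^sup>2)"
  proof (rule sum_mono)
    fix j assume j: "j \<in> {..k}"
    show "Q.prob (many j) \<le> (if j = 0 then 0 else (\<beta> * C / real k)\<^sup>2)"
      unfolding many_def law[OF A[OF j]] mA[OF j]
      using poisson0_pmf_ge_2[of 0] poisson0_pmf_ge_2[of "\<beta> * C / real k"] bC by simp
  qed
  also have "\<dots> = (\<beta> * C)\<^sup>2 / real k"
  proof -
    have "{..k} = insert 0 {1..k}" by auto
    then have "(\<Sum>j\<in>{..k}. if j = 0 then 0 else (\<beta> * C / real k)\<^sup>2) = (\<Sum>j\<in>{1..k}. (\<beta> * C / real k)\<^sup>2)"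
      by simp
    then show ?thesis using C by (simp add: power2_eq_square)
  qed
  also have "Q.prob large = measure_pmf.prob (poisson_pmf (\<beta> * C)) {L<..}"
    using law[of UNIV "{L<..}"] U.prob_space sets_eq_imp_space_eq[OF sets_uniform_Icc[of C]] C(1) beta
    by (simp add: large_def poisson0_pmf_def)
  finally have bad: "Q.prob (large \<union> (\<Union>j\<in>{..k}. many j))
      \<le> measure_pmf.prob (poisson_pmf (\<beta> * C)) {L<..} + (\<beta> * C)\<^sup>2 / real k" by simp
  \<comment> \<open>The bound is tested on the empty configuration.\<close>
  have Bnn: "B \<ge> 0" using B[of "atoms_measure C {} (\<lambda>_. 0)"] atoms_measure_in_counting_measures[of "{}" "\<lambda>_. 0" C]
    by fastforce
  have \<Phi>: "poisson_measure_map C \<in> ?Q \<rightarrow>\<^sub>M borel_of (counting_topology C)"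
    using C(1) by (intro measurable_poisson_measure_map) auto
  have "\<bar>Q.expectation (\<lambda>\<omega>. h (poisson_measure_map C \<omega>))
      - (\<Sum>S\<in>Pow {..k}. h (atoms_measure C S (cell_point C k)) * occupancy_prob (\<lambda>j. \<P>(\<omega> in ?Q. Y j \<omega>)) {..k} S)\<bar>
    \<le> e + 2 * B * Q.prob (large \<union> (\<Union>j\<in>{..k}. many j))"
  proof (rule Q.expectation_approx_occupied_set)
    show "(\<lambda>\<omega>. h (poisson_measure_map C \<omega>)) \<in> borel_measurable ?Q"
      using measurable_compose[OF \<Phi> h] by simp
    show "\<bar>h (poisson_measure_map C \<omega>)\<bar> \<le> B" if "\<omega> \<in> space ?Q" for \<omega>
      using measurable_space[OF \<Phi> that] by (intro B) simp
    show "\<bar>h (atoms_measure C S (cell_point C k))\<bar> \<le> B" if "S \<subseteq> {..k}" for S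
      using that cell_point_in[OF C] by (intro B atoms_measure_in_counting_measures) (auto intro: finite_subset)
    show "large \<union> (\<Union>j\<in>{..k}. many j) \<in> Q.events" using ev ev_large by auto
    fix \<omega> assume \<omega>: "\<omega> \<in> space ?Q" "\<omega> \<notin> large \<union> (\<Union>j\<in>{..k}. many j)"
    obtain n u where nu: "\<omega> = (n, u)" by (cases \<omega>)
    define y where "y i = clamp_Icc C (u i)" for i
    have y: "y i \<in> {0..C}" for i unfolding y_def using C(1) by (rule clamp_Icc_in)
    have cell_y: "cell C k (y i) \<in> {..k}" for i using cell_le[OF C y] by simp
    have pc: "points_count (A j) \<omega> = card {i \<in> {..<n}. cell C k (y i) = j}" for j
      using y by (auto simp: points_count_def nu A_def cell_set_def y_def intro!: arg_cong[of _ _ card])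
    have "card {..<n} \<le> L" using \<omega> by (auto simp: large_def points_count_def nu)
    moreover have "inj_on (\<lambda>i. cell C k (y i)) {..<n}"
    proof (rule inj_onI)
      fix i i' assume i: "i \<in> {..<n}" "i' \<in> {..<n}" "cell C k (y i) = cell C k (y i')"
      have "card {i'' \<in> {..<n}. cell C k (y i'') = cell C k (y i)} \<le> 1"
        using \<omega> cell_y[of i] unfolding many_def pc[symmetric] by fastforce
      then show "i = i'" using i by (auto simp: card_le_Suc0_iff_eq)
    qed
    ultimately have "\<bar>h (atoms_measure C {..<n} y)
        - h (atoms_measure C ((\<lambda>i. cell C k (y i)) ` {..<n}) (cell_point C k))\<bar> < e"
      using y by (intro discretise_atoms_measure[OF C d k]) auto
    moreover have "(\<lambda>i. cell C k (y i)) ` {..<n} = {j \<in> {..k}. Y j \<omega>}"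
      using cell_y by (auto simp: Y_def pc card_gt_0_iff)
    ultimately show "\<bar>h (poisson_measure_map C \<omega>) - h (atoms_measure C {j \<in> {..k}. Y j \<omega>} (cell_point C k))\<bar> \<le> e"
      by (simp add: nu poisson_measure_map_def y_def[abs_def])
  qed (use e Y in auto)
  also have "\<dots> \<le> e + 2 * B * (measure_pmf.prob (poisson_pmf (\<beta> * C)) {L<..} + (\<beta> * C)\<^sup>2 / real k)"
    using bad Bnn by (intro add_left_mono mult_left_mono) auto
  also have "(\<Sum>S\<in>Pow {..k}. h (atoms_measure C S (cell_point C k)) * occupancy_prob (\<lambda>j. \<P>(\<omega> in ?Q. Y j \<omega>)) {..k} S)
     = (\<Sum>S\<in>Pow {..k}. h (atoms_measure C S (cell_point C k)) * occupancy_prob (poisson_occupancy (\<beta> * C) k) {..k} S)"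
    unfolding occupancy_prob_def
    by (intro sum.cong refl arg_cong2[of _ _ _ _ "(*)"] prod.cong) (simp_all add: probY)
  finally show ?thesis .
qed

section \<open>Exceedances of a moving average\<close>

text \<open>The number \<open>r\<close> bounds the support of the coefficients, so
  \<open>X i\<close> depends only on noise within distance \<open>r\<close> of \<open>i\<close>.
  That \<open>r\<close> is at least 1 makes indices more than \<open>2 * r\<close> apart distinct
  and \<open>2 * r\<close> an admissible range in the conditional hypothesis.\<close>

locale moving_average_process = prob_space M
  for M :: "'a measure" and \<epsilon> :: "int \<Rightarrow> 'a \<Rightarrow> real" and \<theta> :: "int \<Rightarrow> real" and r :: int +
  assumes indep: "indep_vars (\<lambda>_. borel) \<epsilon> UNIV"
    and ident: "\<And>i. distr M borel (\<epsilon> i) = distr M borel (\<epsilon> 0)"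
    and range: "\<And>k. \<theta> k \<noteq> 0 \<Longrightarrow> \<bar>k\<bar> \<le> r"
    and r_ge_1: "r \<ge> 1"
begin

abbreviation X :: "int \<Rightarrow> 'a \<Rightarrow> real" where
  "X \<equiv> moving_average \<theta> \<epsilon>"

section \<open>Stationarity and range of dependence\<close>

lemma noise_measurable: "\<epsilon> i \<in> borel_measurable M"
  using indep by (auto simp: indep_vars_def)

lemma X_measurable [measurable]: "X i \<in> borel_measurable M"
  unfolding moving_average_def by (intro borel_measurable_sum borel_measurable_times noise_measurable) auto

lemma distr_noise_shift:
  "distr M (PiM UNIV (\<lambda>_. borel)) (\<lambda>\<omega> l. \<epsilon> (l + s) \<omega>) = PiM UNIV (\<lambda>_. distr M borel (\<epsilon> 0))"
proof -
  have "indep_vars (\<lambda>_. borel) (\<lambda>l. \<epsilon> (l + s)) UNIV"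
    using indep by (intro indep_vars_reindex[where f = "\<lambda>l. l + s"]) (auto intro: indep_vars_subset)
  then have "distr M (PiM UNIV (\<lambda>_. borel)) (\<lambda>\<omega>. \<lambda>l\<in>UNIV. \<epsilon> (l + s) \<omega>)
      = PiM UNIV (\<lambda>l. distr M borel (\<epsilon> (l + s)))"
    using indep_vars_iff_distr_eq_PiM[where I = UNIV and M' = "\<lambda>_. borel" and X = "\<lambda>l. \<epsilon> (l + s)"] noise_measurable by simp
  moreover have "(\<lambda>l. distr M borel (\<epsilon> (l + s))) = (\<lambda>_. distr M borel (\<epsilon> 0))"
    using ident by blast
  ultimately show ?thesis by (simp add: restrict_def)
qed

text \<open>The process is a fixed measurable function \<open>T\<close> of the noise sequence,
  \<open>T\<close> commutes with shifts, and shifted noise has the same product law. Invariance is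
  needed for the whole sequence because \<open>\<psi>\<close> involves several indices.\<close>

lemma distr_X_shift:
  "distr M (PiM UNIV (\<lambda>_. borel)) (\<lambda>\<omega> l. X (l + s) \<omega>) = distr M (PiM UNIV (\<lambda>_. borel)) (\<lambda>\<omega> l. X l \<omega>)"
proof -
  let ?N = "PiM UNIV (\<lambda>_. borel) :: (int \<Rightarrow> real) measure"
  define T where "T e l = (\<Sum>k | \<theta> k \<noteq> 0. \<theta> k * e (l + k))" for e :: "int \<Rightarrow> real" and l
  have T: "T \<in> ?N \<rightarrow>\<^sub>M ?N"
    unfolding T_def
    by (intro measurable_PiM_single' borel_measurable_sum borel_measurable_times
        measurable_component_singleton borel_measurable_const) (auto simp: space_PiM)
  have e: "(\<lambda>\<omega> l. \<epsilon> (l + s) \<omega>) \<in> M \<rightarrow>\<^sub>M ?N" for s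
    using noise_measurable by (intro measurable_PiM_single') (auto simp: space_PiM)
  have "(\<lambda>\<omega> l. X (l + s) \<omega>) = T \<circ> (\<lambda>\<omega> l. \<epsilon> (l + s) \<omega>)" for s
    by (simp add: fun_eq_iff T_def moving_average_def algebra_simps)
  then have "distr M ?N (\<lambda>\<omega> l. X (l + s) \<omega>) = distr (PiM UNIV (\<lambda>_. distr M borel (\<epsilon> 0))) ?N T" for s
    using distr_distr[OF T e, of s] by (simp add: distr_noise_shift)
  from this[of s] this[of 0] show ?thesis by simp
qed

lemma prob_X_shift:
  assumes "{f. P f} \<in> sets (PiM UNIV (\<lambda>_. borel))"
  shows "\<P>(\<omega> in M. P (\<lambda>l. X (l + s) \<omega>)) = \<P>(\<omega> in M. P (\<lambda>l. X l \<omega>))"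
proof -
  have *: "\<P>(\<omega> in M. P (\<lambda>l. X (l + s) \<omega>)) = measure (distr M (PiM UNIV (\<lambda>_. borel)) (\<lambda>\<omega> l. X (l + s) \<omega>)) {f. P f}" for s
  proof -
    have "(\<lambda>\<omega> l. X (l + s) \<omega>) \<in> M \<rightarrow>\<^sub>M PiM UNIV (\<lambda>_. borel)"
      by (intro measurable_PiM_single') (auto simp: space_PiM)
    then have "measure (distr M (PiM UNIV (\<lambda>_. borel)) (\<lambda>\<omega> l. X (l + s) \<omega>)) {f. P f}
        = prob ((\<lambda>\<omega> l. X (l + s) \<omega>) -` {f. P f} \<inter> space M)"
      using assms by (subst measure_distr) auto
    also have "(\<lambda>\<omega> l. X (l + s) \<omega>) -` {f. P f} \<inter> space M = {\<omega> \<in> space M. P (\<lambda>l. X (l + s) \<omega>)}" by auto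
    finally show ?thesis ..
  qed
  from *[of s] *[of 0] show ?thesis by (simp add: distr_X_shift)
qed

definition exceed :: "real \<Rightarrow> int \<Rightarrow> 'a set" where
  "exceed u i = {\<omega> \<in> space M. X i \<omega> > u}"

lemma exceed_events [measurable]: "exceed u i \<in> events"
  unfolding exceed_def by measurable

definition p where "p u = prob (exceed u 0)"

text \<open>A joint rather than a conditional probability, since union bounds add it over indices.
  Within distance \<open>2 * r\<close> the variables may share noise.\<close>

definition \<psi> where "\<psi> u = \<P>(\<omega> in M. (\<exists>i. 1 \<le> \<bar>i\<bar> \<and> \<bar>i\<bar> \<le> 2 * r \<and> X i \<omega> > u) \<and> X 0 \<omega> > u)"

lemma p_nonneg: "p u \<ge> 0" by (simp add: p_def)

lemma \<psi>_nonneg: "\<psi> u \<ge> 0" by (simp add: \<psi>_def)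

lemma prob_exceed: "prob (exceed u i) = p u"
proof -
  have "{f :: int \<Rightarrow> real. f 0 > u} \<in> sets (PiM UNIV (\<lambda>_. borel))"
    using sets_Collect_single[of "0::int" UNIV "{u<..}" "\<lambda>_. borel"] by (simp add: space_PiM)
  from prob_X_shift[OF this, of i] show ?thesis by (simp add: p_def exceed_def)
qed

lemma prob_near: "\<P>(\<omega> in M. (\<exists>l. 1 \<le> \<bar>l\<bar> \<and> \<bar>l\<bar> \<le> 2 * r \<and> X (l + i) \<omega> > u) \<and> X i \<omega> > u) = \<psi> u"
proof -
  let ?N = "PiM UNIV (\<lambda>_. borel) :: (int \<Rightarrow> real) measure"
  have 1: "{f \<in> space ?N. f l > u} \<in> sets ?N" for l
    using sets_Collect_single[of l UNIV "{u<..}" "\<lambda>_. borel"] by simp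
  have fin: "finite {l :: int. 1 \<le> \<bar>l\<bar> \<and> \<bar>l\<bar> \<le> 2 * r}"
    by (rule finite_subset[of _ "{-2*r..2*r}"]) auto
  have "{f \<in> space ?N. (\<exists>l\<in>{l. 1 \<le> \<bar>l\<bar> \<and> \<bar>l\<bar> \<le> 2 * r}. f l > u) \<and> f 0 > u} \<in> sets ?N"
    by (intro sets.sets_Collect_conj sets.sets_Collect_finite_Ex 1 fin)
  then have "{f. (\<exists>l. 1 \<le> \<bar>l\<bar> \<and> \<bar>l\<bar> \<le> 2 * r \<and> f l > u) \<and> f 0 > u} \<in> sets ?N"
    by (simp add: space_PiM Bex_def conj_assoc)
  from prob_X_shift[OF this, of i] show ?thesis by (simp add: \<psi>_def)
qed

text \<open>A block depends only on the noise in its \<open>r\<close>-neighbourhood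
  \<open>K j\<close>, and separation beyond \<open>2 * r\<close> makes these neighbourhoods
  disjoint.\<close>

lemma indep_blocks:
  fixes W :: "'j \<Rightarrow> int set"
  assumes fin: "\<And>j. j \<in> J \<Longrightarrow> finite (W j)"
    and sep: "\<And>j j' i i'. j \<in> J \<Longrightarrow> j' \<in> J \<Longrightarrow> j \<noteq> j' \<Longrightarrow> i \<in> W j \<Longrightarrow> i' \<in> W j' \<Longrightarrow> \<bar>i - i'\<bar> > 2 * r"
  shows "indep_vars (\<lambda>_. count_space UNIV) (\<lambda>j \<omega>. \<exists>i\<in>W j. X i \<omega> > u) J"
proof -
  define K where "K j = {i + k | i k. i \<in> W j \<and> \<bar>k\<bar> \<le> r}" for j
  have K: "i + k \<in> K j" if "i \<in> W j" "\<theta> k \<noteq> 0" for i k j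
    using that range[of k] by (auto simp: K_def)
  have disj: "disjoint_family_on K J"
  proof (unfold disjoint_family_on_def, intro ballI impI equals0I)
    fix j j' x assume j: "j \<in> J" "j' \<in> J" "j \<noteq> j'" "x \<in> K j \<inter> K j'"
    then obtain i k where "x = i + k" "i \<in> W j" "\<bar>k\<bar> \<le> r" unfolding K_def by blast
    moreover obtain i' k' where "x = i' + k'" "i' \<in> W j'" "\<bar>k'\<bar> \<le> r"
      using j(4) unfolding K_def by blast
    ultimately show False using sep[OF j(1-3), of i i'] by auto
  qed
  define Y where "Y j e \<longleftrightarrow> (\<exists>i\<in>W j. (\<Sum>k | \<theta> k \<noteq> 0. \<theta> k * e (i + k)) > u)" for j and e :: "int \<Rightarrow> real"
  have "Y j \<in> PiM (K j) (\<lambda>_. borel) \<rightarrow>\<^sub>M count_space UNIV" if "j \<in> J" for j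
  proof -
    have [measurable]: "(\<lambda>e. \<Sum>k | \<theta> k \<noteq> 0. \<theta> k * e (i + k)) \<in> borel_measurable (PiM (K j) (\<lambda>_. borel))"
      if "i \<in> W j" for i
      using K[OF that]
      by (intro borel_measurable_sum borel_measurable_times measurable_component_singleton borel_measurable_const) auto
    show ?thesis unfolding Y_def by (rule pred_intros_finite(4)[OF fin[OF that]]) measurable
  qed
  moreover have "indep_vars (\<lambda>j. PiM (K j) (\<lambda>_. borel)) (\<lambda>j \<omega>. restrict (\<lambda>i. \<epsilon> i \<omega>) (K j)) J"
    by (rule indep_vars_restrict[OF indep _ disj]) auto
  ultimately have "indep_vars (\<lambda>_. count_space UNIV) (\<lambda>j \<omega>. Y j (restrict (\<lambda>i. \<epsilon> i \<omega>) (K j))) J"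
    by (intro indep_vars_compose2[where Y = Y])
  moreover have "Y j (restrict (\<lambda>i. \<epsilon> i \<omega>) (K j)) \<longleftrightarrow> (\<exists>i\<in>W j. X i \<omega> > u)" for j \<omega>
    unfolding Y_def moving_average_def using K
    by (intro bex_cong refl arg_cong2[of _ _ _ _ "(<)"] sum.cong) auto
  ultimately show ?thesis by simp
qed

lemma prob_far:
  assumes "\<bar>i - i'\<bar> > 2 * r"
  shows "prob (exceed u i \<inter> exceed u i') = (p u)\<^sup>2"
proof -
  have ne: "i \<noteq> i'" using assms r_ge_1 by auto
  have ind: "indep_vars (\<lambda>_. count_space UNIV) (\<lambda>j \<omega>. \<exists>i\<in>{j}. X i \<omega> > u) {i, i'}"
    using assms by (intro indep_blocks) auto
  have e: "(\<lambda>\<omega>. \<exists>i\<in>{j}. X i \<omega> > u) -` {True} \<inter> space M = exceed u j" for j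
    by (auto simp: exceed_def)
  have "prob (\<Inter>j\<in>{i, i'}. exceed u j) = (\<Prod>j\<in>{i, i'}. prob (exceed u j))"
    unfolding e[symmetric] by (rule indep_varsD_finite[OF ind]) auto
  then show ?thesis using ne by (simp add: prob_exceed power2_eq_square)
qed

text \<open>Nearby exceedances are controlled by the conditional probability hypothesis, distant ones by
  independence.\<close>

lemma prob_other_exceed:
  assumes "finite W"
  shows "prob (exceed u i \<inter> (\<Union>i'\<in>W - {i}. exceed u i')) \<le> \<psi> u + real (card W) * (p u)\<^sup>2"
proof -
  let ?near = "{\<omega> \<in> space M. (\<exists>l. 1 \<le> \<bar>l\<bar> \<and> \<bar>l\<bar> \<le> 2 * r \<and> X (l + i) \<omega> > u) \<and> X i \<omega> > u}"
  let ?far = "\<Union>i'\<in>{i'\<in>W. \<bar>i - i'\<bar> > 2 * r}. exceed u i \<inter> exceed u i'"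
  have near: "?near \<in> events"
  proof -
    have fin: "finite {l :: int. 1 \<le> \<bar>l\<bar> \<and> \<bar>l\<bar> \<le> 2 * r}"
      by (rule finite_subset[of _ "{-2*r..2*r}"]) auto
    have "{\<omega> \<in> space M. (\<exists>l\<in>{l. 1 \<le> \<bar>l\<bar> \<and> \<bar>l\<bar> \<le> 2 * r}. X (l + i) \<omega> > u) \<and> X i \<omega> > u} \<in> events"
      using exceed_events unfolding exceed_def
      by (intro sets.sets_Collect_conj sets.sets_Collect_finite_Ex fin)
    then show ?thesis by (simp add: Bex_def conj_assoc)
  qed
  have far: "?far \<in> events" using assms by auto
  have "exceed u i \<inter> (\<Union>i'\<in>W - {i}. exceed u i') \<subseteq> ?near \<union> ?far"
  proof
    fix \<omega> assume "\<omega> \<in> exceed u i \<inter> (\<Union>i'\<in>W - {i}. exceed u i')"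
    then obtain i' where i': "i' \<in> W" "i' \<noteq> i" "\<omega> \<in> exceed u i" "\<omega> \<in> exceed u i'" by auto
    show "\<omega> \<in> ?near \<union> ?far"
    proof (cases "\<bar>i - i'\<bar> > 2 * r")
      case False
      then have "\<exists>l. 1 \<le> \<bar>l\<bar> \<and> \<bar>l\<bar> \<le> 2 * r \<and> X (l + i) \<omega> > u"
        using i' by (intro exI[of _ "i' - i"]) (auto simp: exceed_def)
      then show ?thesis using i' by (auto simp: exceed_def)
    qed (use i' in auto)
  qed
  then have "prob (exceed u i \<inter> (\<Union>i'\<in>W - {i}. exceed u i')) \<le> prob (?near \<union> ?far)"
    using near far by (intro finite_measure_mono) auto
  also have "\<dots> \<le> prob ?near + prob ?far"
    using near far by (intro measure_Un_le) auto
  also have "prob ?near = \<psi> u" by (rule prob_near)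
  also have "prob ?far \<le> (\<Sum>i'\<in>{i'\<in>W. \<bar>i - i'\<bar> > 2 * r}. prob (exceed u i \<inter> exceed u i'))"
    using assms by (intro finite_measure_subadditive_finite) auto
  also have "\<dots> = real (card {i'\<in>W. \<bar>i - i'\<bar> > 2 * r}) * (p u)\<^sup>2"
    by (simp add: prob_far)
  also have "\<dots> \<le> real (card W) * (p u)\<^sup>2"
    using assms by (intro mult_right_mono of_nat_mono card_mono) auto
  finally show ?thesis by simp
qed

definition pair_event where
  "pair_event u W = (\<Union>i\<in>W. exceed u i \<inter> (\<Union>i'\<in>W - {i}. exceed u i'))"

lemma pair_event_events: "finite W \<Longrightarrow> pair_event u W \<in> events"
  unfolding pair_event_def by auto

text \<open>A union bound over one of the two indices. The real number \<open>w\<close> stands in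
  for the cardinality so that blocks of slightly different sizes share one estimate.\<close>

lemma prob_pair_event:
  assumes "finite W" "real (card W) \<le> w"
  shows "prob (pair_event u W) \<le> w * (\<psi> u + w * (p u)\<^sup>2)"
proof -
  have w: "w \<ge> 0" using assms(2) of_nat_0_le_iff order_trans by blast
  have "prob (pair_event u W) \<le> (\<Sum>i\<in>W. prob (exceed u i \<inter> (\<Union>i'\<in>W - {i}. exceed u i')))"
    unfolding pair_event_def using assms(1) by (intro finite_measure_subadditive_finite) auto
  also have "\<dots> \<le> (\<Sum>i\<in>W. \<psi> u + w * (p u)\<^sup>2)"
    using assms
    by (intro sum_mono order_trans[OF prob_other_exceed] add_left_mono mult_right_mono) auto
  also have "\<dots> = real (card W) * (\<psi> u + w * (p u)\<^sup>2)" by simp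
  also have "\<dots> \<le> w * (\<psi> u + w * (p u)\<^sup>2)"
    using assms w \<psi>_nonneg by (intro mult_right_mono) auto
  finally show ?thesis .
qed

lemma prob_block_le:
  assumes "finite W"
  shows "prob (\<Union>i\<in>W. exceed u i) \<le> real (card W) * p u"
proof -
  have "prob (\<Union>i\<in>W. exceed u i) \<le> (\<Sum>i\<in>W. prob (exceed u i))"
    using assms by (intro finite_measure_subadditive_finite) auto
  then show ?thesis by (simp add: prob_exceed)
qed

text \<open>A Bonferroni-type bound: the events \<open>E i\<close>, where \<open>i\<close> is the
  only exceedance in \<open>W\<close>, are disjoint, and each falls short of \<open>p u\<close> by
  at most the probability of a second exceedance.\<close>

lemma prob_block_ge:
  assumes "finite W" "real (card W) \<le> w"
  shows "prob (\<Union>i\<in>W. exceed u i) \<ge> real (card W) * p u - w * (\<psi> u + w * (p u)\<^sup>2)"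
proof -
  have w: "w \<ge> 0" using assms(2) of_nat_0_le_iff order_trans by blast
  define E where "E i = exceed u i - (\<Union>i'\<in>W - {i}. exceed u i')" for i
  have E: "E i \<in> events" for i unfolding E_def using assms(1) by auto
  have "p u - (\<psi> u + w * (p u)\<^sup>2) \<le> prob (E i)" for i
  proof -
    have "prob (exceed u i) = prob (E i) + prob (exceed u i \<inter> (\<Union>i'\<in>W - {i}. exceed u i'))"
      unfolding E_def using assms(1)
      by (subst finite_measure_Diff') (auto simp: Int_commute)
    moreover have "prob (exceed u i \<inter> (\<Union>i'\<in>W - {i}. exceed u i')) \<le> \<psi> u + w * (p u)\<^sup>2"
      using assms(2) by (intro order_trans[OF prob_other_exceed[OF assms(1)]] add_left_mono mult_right_mono) auto
    ultimately show ?thesis by (simp add: prob_exceed)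
  qed
  then have "(\<Sum>i\<in>W. p u - (\<psi> u + w * (p u)\<^sup>2)) \<le> (\<Sum>i\<in>W. prob (E i))" by (intro sum_mono)
  also have "\<dots> = prob (\<Union>i\<in>W. E i)"
  proof (rule finite_measure_finite_Union[symmetric, OF assms(1)])
    show "disjoint_family_on E W" by (auto simp: disjoint_family_on_def E_def)
  qed (use E in auto)
  also have "\<dots> \<le> prob (\<Union>i\<in>W. exceed u i)"
    using assms(1) by (intro finite_measure_mono) (auto simp: E_def)
  finally have "real (card W) * p u - real (card W) * (\<psi> u + w * (p u)\<^sup>2) \<le> prob (\<Union>i\<in>W. exceed u i)"
    by (simp add: algebra_simps)
  moreover have "real (card W) * (\<psi> u + w * (p u)\<^sup>2) \<le> w * (\<psi> u + w * (p u)\<^sup>2)"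
    using assms w \<psi>_nonneg by (intro mult_right_mono) auto
  ultimately show ?thesis by linarith
qed

end

section \<open>Blocks of indices and first-order occupation bounds\<close>

definition block_end :: "real \<Rightarrow> nat \<Rightarrow> nat \<Rightarrow> nat \<Rightarrow> int" where
  "block_end C k \<nu> j = \<lfloor>cell_point C k j * real \<nu>\<rfloor>"

text \<open>For \<open>s = 0\<close> these are the indices whose rescaled position lies in cell
  \<open>j\<close>; \<open>s = 2 * r\<close> separates neighbouring blocks. A cell with at most
  \<open>s\<close> indices gets an empty block, and cell 0 has none because indices start at
  1.\<close>

definition index_block :: "real \<Rightarrow> nat \<Rightarrow> nat \<Rightarrow> int \<Rightarrow> nat \<Rightarrow> int set" where
  "index_block C k \<nu> s j = (case j of 0 \<Rightarrow> {} | Suc i \<Rightarrow> {block_end C k \<nu> i<..block_end C k \<nu> (Suc i) - s})"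

lemma finite_index_block [simp]: "finite (index_block C k \<nu> s j)"
  by (simp add: index_block_def split: nat.splits)

lemma index_block_mono: "s \<ge> 0 \<Longrightarrow> index_block C k \<nu> s j \<subseteq> index_block C k \<nu> 0 j"
  by (auto simp: index_block_def split: nat.splits)

lemma block_end_mono:
  assumes "C > 0" "i \<le> j"
  shows "block_end C k \<nu> i \<le> block_end C k \<nu> j"
  unfolding block_end_def cell_point_def using assms
  by (intro floor_mono mult_right_mono divide_right_mono) auto

text \<open>On the index scale a cell has length \<open>C * real \<nu> / real k\<close>; rounding
  both ends down changes this by less than 1.\<close>

lemma card_index_block:
  assumes "C > 0" "k > 0" "s \<ge> 0"
  shows "real (card (index_block C k \<nu> s j)) \<le> C * real \<nu> / real k + 1"
    and "real (card (index_block C k \<nu> s (Suc j))) \<ge> C * real \<nu> / real k - 1 - of_int s"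
proof -
  have diff: "cell_point C k (Suc i) * real \<nu> - cell_point C k i * real \<nu> = C * real \<nu> / real k" for i
    by (simp add: cell_point_def field_simps) (simp add: add_divide_distrib algebra_simps)
  have fl: "real_of_int (block_end C k \<nu> (Suc i)) - real_of_int (block_end C k \<nu> i) \<le> C * real \<nu> / real k + 1"
    "real_of_int (block_end C k \<nu> (Suc i)) - real_of_int (block_end C k \<nu> i) \<ge> C * real \<nu> / real k - 1" for i
    unfolding block_end_def diff[symmetric, of i] by linarith+
  show "real (card (index_block C k \<nu> s (Suc j))) \<ge> C * real \<nu> / real k - 1 - of_int s"
    using fl(2)[of j] by (simp add: index_block_def)
  show "real (card (index_block C k \<nu> s j)) \<le> C * real \<nu> / real k + 1"
  proof (cases j)
    case 0
    then show ?thesis using assms by (simp add: index_block_def)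
  next
    case (Suc i)
    have "0 \<le> C * real \<nu> / real k + 1" using assms by simp
    then show ?thesis using fl(1)[of i] assms(3) by (simp add: index_block_def Suc)
  qed
qed

lemma cell_index:
  assumes "C > 0" "k > 0" "\<nu> > 0" "i \<ge> 1"
  shows "cell C k (real_of_int i / real \<nu>) = j \<longleftrightarrow> i \<in> index_block C k \<nu> 0 j"
proof -
  have pos: "real_of_int i / real \<nu> > 0" using assms by simp
  show ?thesis
  proof (cases j)
    case 0
    then show ?thesis using cell_eq_iff(2)[OF assms(1,2) less_imp_le[OF pos]] assms(3,4)
      by (simp add: index_block_def)
  next
    case (Suc j')
    have "cell C k (real_of_int i / real \<nu>) = j \<longleftrightarrow>
        cell_point C k j' * real \<nu> < real_of_int i \<and> real_of_int i \<le> cell_point C k (Suc j') * real \<nu>"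
      using cell_eq_iff(1)[OF assms(1,2) less_imp_le[OF pos]] assms(3) by (simp add: Suc field_simps)
    then show ?thesis
      by (simp add: index_block_def Suc block_end_def floor_less_iff le_floor_iff)
  qed
qed

text \<open>With \<open>x = l / real k\<close>, \<open>exp (- x)\<close> is at most
  \<open>1 / (1 + x)\<close>, which is at most \<open>1 - x + x\<^sup>2\<close> because the product
  of the latter with \<open>1 + x\<close> is 1 plus the cube of \<open>x\<close>.\<close>

lemma poisson_occupancy_bounds:
  assumes "l \<ge> 0" "j > 0" "k > 0"
  shows "poisson_occupancy l k j \<le> l / real k"
    and "poisson_occupancy l k j \<ge> l / real k - (l / real k)\<^sup>2"
proof -
  define x where "x = l / real k"
  have x: "x \<ge> 0" using assms by (simp add: x_def)
  have "exp x \<ge> 1 + x" by (rule exp_ge_add_one_self)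
  then have "exp (- x) \<le> 1 / (1 + x)"
    using x by (simp add: exp_minus divide_simps)
  also have "1 \<le> (1 - x + x\<^sup>2) * (1 + x)"
    using zero_le_power[OF x, of 3] by (simp add: algebra_simps power2_eq_square power3_eq_cube)
  then have "1 / (1 + x) \<le> 1 - x + x\<^sup>2"
    using x by (simp add: divide_simps)
  finally have "exp (- x) \<le> 1 - x + x\<^sup>2" .
  then show "poisson_occupancy l k j \<ge> l / real k - (l / real k)\<^sup>2"
    using assms(2) by (simp add: poisson_occupancy_def x_def)
  show "poisson_occupancy l k j \<le> l / real k"
    using assms(2) exp_ge_add_one_self[of "- x"] by (simp add: poisson_occupancy_def x_def)
qed

context moving_average_process
begin

section \<open>Comparing the exceedance process with its blocks\<close>

definition exceedances :: "real \<Rightarrow> int \<Rightarrow> 'a \<Rightarrow> int set" where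
  "exceedances u n \<omega> = {i \<in> {1..n}. X i \<omega> > u}"

lemma finite_exceedances [simp]: "finite (exceedances u n \<omega>)"
  unfolding exceedances_def by (rule finite_subset[of _ "{1..n}"]) auto

text \<open>The random index set has finitely many possible values, so every predicate of it defines
  an event; no knowledge of the open sets is required to see that the exceedance process is
  measurable.\<close>

lemma exceedances_events: "{\<omega> \<in> space M. P (exceedances u n \<omega>)} \<in> events"
proof -
  have 1: "{\<omega> \<in> space M. \<forall>i\<in>{1..n}. (X i \<omega> > u) = (i \<in> A)} \<in> events" for A
    by (intro sets.sets_Collect_finite_All) auto
  have "{\<omega> \<in> space M. P (exceedances u n \<omega>)}
      = (\<Union>A\<in>{A \<in> Pow {1..n}. P A}. {\<omega> \<in> space M. \<forall>i\<in>{1..n}. (X i \<omega> > u) = (i \<in> A)})" (is "?L = ?R")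
  proof (intro equalityI subsetI)
    fix \<omega> assume "\<omega> \<in> ?L"
    then show "\<omega> \<in> ?R" by (auto intro!: exI[of _ "exceedances u n \<omega>"] simp: exceedances_def)
  next
    fix \<omega> assume "\<omega> \<in> ?R"
    then obtain A where A: "A \<subseteq> {1..n}" "P A" "\<omega> \<in> space M" "\<forall>i\<in>{1..n}. (X i \<omega> > u) = (i \<in> A)" by auto
    then have "exceedances u n \<omega> = A" by (auto simp: exceedances_def)
    then show "\<omega> \<in> ?L" using A by simp
  qed
  then show ?thesis using 1 by (auto intro!: sets.finite_UN)
qed

text \<open>Markov's inequality at level \<open>L + 1\<close>, the least integer above
  \<open>L\<close>.\<close>

lemma prob_many_exceedances:
  fixes L :: nat
  shows "\<P>(\<omega> in M. card (exceedances u n \<omega>) > L) \<le> real (nat n) * p u / (real L + 1)"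
proof -
  let ?E = "{\<omega> \<in> space M. card (exceedances u n \<omega>) > L}"
  have E: "?E \<in> events" by (rule exceedances_events)
  have "(real L + 1) * prob ?E = expectation (\<lambda>\<omega>. (real L + 1) * indicator ?E \<omega>)"
    using E by simp
  also have "\<dots> \<le> expectation (\<lambda>\<omega>. \<Sum>i\<in>{1..n}. indicator (exceed u i) \<omega>)"
  proof (rule integral_mono)
    show "integrable M (\<lambda>\<omega>. (real L + 1) * indicator ?E \<omega>)" using E by (auto simp: less_top[symmetric])
    show "integrable M (\<lambda>\<omega>. \<Sum>i\<in>{1..n}. indicator (exceed u i) \<omega> :: real)" by (auto simp: less_top[symmetric])
    fix \<omega> assume \<omega>: "\<omega> \<in> space M"
    have "(\<Sum>i\<in>{1..n}. indicator (exceed u i) \<omega> :: real) = real (card (exceedances u n \<omega>))"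
      using \<omega> by (simp add: indicator_def exceed_def exceedances_def sum.If_cases Int_def)
    then show "(real L + 1) * indicator ?E \<omega> \<le> (\<Sum>i\<in>{1..n}. indicator (exceed u i) \<omega>)"
      by (auto simp: indicator_def)
  qed
  also have "\<dots> = real (nat n) * p u"
    by (subst Bochner_Integration.integral_sum) (auto simp: prob_exceed less_top[symmetric])
  finally show ?thesis by (simp add: field_simps)
qed

lemma exceedance_process_eq:
  assumes "C > 0" "\<nu> > 0"
  shows "exceedance_process X C u \<nu> \<omega>
     = atoms_measure C (exceedances u \<lfloor>C * real \<nu>\<rfloor> \<omega>) (\<lambda>i. real_of_int i / real \<nu>)"
    and "(\<lambda>i. real_of_int i / real \<nu>) \<in> exceedances u \<lfloor>C * real \<nu>\<rfloor> \<omega> \<rightarrow> {0..C}"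
proof -
  let ?I = "exceedances u \<lfloor>C * real \<nu>\<rfloor> \<omega>" and ?f = "\<lambda>i. real_of_int i / real \<nu>"
  have *: "?f i \<le> C \<longleftrightarrow> i \<le> \<lfloor>C * real \<nu>\<rfloor>" for i
    using assms by (simp add: le_floor_iff divide_simps)
  then show f: "?f \<in> ?I \<rightarrow> {0..C}" by (auto simp: exceedances_def)
  have "{real_of_int i / real \<nu> | i. 1 \<le> i \<and> X i \<omega> > u} \<inter> {0..C} = ?f ` ?I"
    using * by (auto simp: exceedances_def)
  moreover have "inj_on ?f ?I" using assms by (auto simp: inj_on_def)
  ultimately show "exceedance_process X C u \<nu> \<omega> = atoms_measure C ?I ?f"
    unfolding exceedance_process_def points_measure_eq_atoms_measure using f
    by (subst atoms_measure_reindex[of ?f ?I]) (auto simp: bij_betw_def)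
qed

lemma exceedance_process_measurable:
  assumes "C > 0" "\<nu> > 0"
  shows "exceedance_process X C u \<nu> \<in> M \<rightarrow>\<^sub>M borel_of (counting_topology C)"
proof (rule measurable_borel_ofI)
  show "exceedance_process X C u \<nu> \<in> space M \<rightarrow> topspace (counting_topology C)"
    unfolding exceedance_process_eq(1)[OF assms, abs_def] topspace_counting_topology
    by (intro Pi_I atoms_measure_in_counting_measures finite_exceedances exceedance_process_eq(2) assms)
  fix U assume "openin (counting_topology C) U"
  have "exceedance_process X C u \<nu> -` U \<inter> space M
      = {\<omega> \<in> space M. atoms_measure C (exceedances u \<lfloor>C * real \<nu>\<rfloor> \<omega>) (\<lambda>i. real_of_int i / real \<nu>) \<in> U}"
    using exceedance_process_eq(1)[OF assms] by auto
  then show "exceedance_process X C u \<nu> -` U \<inter> space M \<in> events"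
    using exceedances_events by simp
qed

definition block_prob :: "real \<Rightarrow> real \<Rightarrow> nat \<Rightarrow> nat \<Rightarrow> nat \<Rightarrow> real" where
  "block_prob u C k \<nu> j = prob (\<Union>i\<in>index_block C k \<nu> (2 * r) j. exceed u i)"

text \<open>An index of the earlier block is at most the end of its cell minus \<open>2 * r\<close>,
  while one of the later block lies strictly beyond that end.\<close>

lemma index_block_separated:
  assumes "C > 0" "j < j'" "i \<in> index_block C k \<nu> (2 * r) j" "i' \<in> index_block C k \<nu> (2 * r) j'"
  shows "i' - i > 2 * r"
proof -
  obtain a where a: "j = Suc a" using assms(3) by (cases j) (auto simp: index_block_def)
  obtain b where b: "j' = Suc b" using assms(2) by (cases j') auto
  have "block_end C k \<nu> j \<le> block_end C k \<nu> b"
    using assms(1,2) b by (intro block_end_mono) auto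
  then show ?thesis using assms(3,4) by (simp add: a b index_block_def)
qed

text \<open>The three error terms bound the exceptional events: more than \<open>L\<close>
  exceedances, two in one full block, and one among the removed indices. Otherwise each occupied
  cell holds exactly one exceedance, which lies in the shortened block. Cells are numbered from 0 to
  \<open>k\<close>, hence the factors \<open>real k + 1\<close>.\<close>

lemma exceedance_expectation_approx:
  assumes C: "C > 0" "k > 0" and \<nu>: "\<nu> > 0"
    and h: "h \<in> borel_measurable (borel_of (counting_topology C))"
    and B: "\<And>\<mu>. \<mu> \<in> counting_measures C \<Longrightarrow> \<bar>h \<mu>\<bar> \<le> B"
    and d: "atoms_modulus C h L e d"
    and e: "e > 0" and k: "C / real k < d"
    and w: "w = C * real \<nu> / real k + 1"
  shows "\<bar>expectation (\<lambda>\<omega>. h (exceedance_process X C u \<nu> \<omega>))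
      - (\<Sum>A\<in>Pow {..k}. h (atoms_measure C A (cell_point C k)) * occupancy_prob (block_prob u C k \<nu>) {..k} A)\<bar>
    \<le> e + 2 * B * (C * real \<nu> * p u / (real L + 1) + (real k + 1) * (w * (\<psi> u + w * (p u)\<^sup>2))
         + (real k + 1) * (2 * of_int r) * p u)"
proof -
  define n where "n = \<lfloor>C * real \<nu>\<rfloor>"
  define y where "y i = real_of_int i / real \<nu>" for i
  define W where "W = index_block C k \<nu> 0"
  define W' where "W' = index_block C k \<nu> (2 * r)"
  \<comment> \<open>For \<open>j = 0\<close> this includes indices that are not positive; they
    merely enlarge the exceptional event.\<close>
  define gap where "gap = (\<Union>j\<in>{..k}. {block_end C k \<nu> j - 2 * r<..block_end C k \<nu> j})"
  have fin: "finite (W j)" "finite (W' j)" "finite gap" for j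
    by (auto simp: W_def W'_def gap_def)
  note eq = exceedance_process_eq[OF C(1) \<nu>, folded n_def y_def[abs_def]]
  have end_k: "block_end C k \<nu> k = n" using C by (simp add: block_end_def n_def cell_point_def)
  have W'_subset: "W' j \<subseteq> W j" for j
    unfolding W_def W'_def using r_ge_1 by (intro index_block_mono) auto
  have W_range: "W j \<subseteq> {1..n}" if "j \<le> k" for j
  proof (cases j)
    case (Suc i)
    have "0 \<le> block_end C k \<nu> i" using block_end_mono[OF C(1), of 0 i k \<nu>] by (simp add: block_end_def cell_point_def)
    moreover have "block_end C k \<nu> j \<le> n" unfolding end_k[symmetric] using that C by (intro block_end_mono)
    ultimately show ?thesis by (auto simp: W_def index_block_def Suc)
  qed (simp add: W_def index_block_def)
  have W_gap: "i \<in> W' j \<or> i \<in> gap" if "i \<in> W j" "j \<le> k" for i j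
  proof (cases j)
    case (Suc a)
    then show ?thesis
      using that by (auto simp: W_def W'_def index_block_def gap_def intro!: bexI[of _ j])
  qed (use that in \<open>simp add: W_def index_block_def\<close>)
  have cell_y: "cell C k (y i) = j \<longleftrightarrow> i \<in> W j" if "i \<ge> 1" for i j
    unfolding y_def W_def using cell_index[OF C \<nu> that] .
  have card_gap: "real (card gap) \<le> (real k + 1) * (2 * of_int r)"
  proof -
    have "card gap \<le> (\<Sum>j\<in>{..k}. card {block_end C k \<nu> j - 2 * r<..block_end C k \<nu> j})"
      unfolding gap_def by (rule card_UN_le) simp
    also have "\<dots> = (k + 1) * nat (2 * r)" by simp
    finally have "real (card gap) \<le> real ((k + 1) * nat (2 * r))" by (rule of_nat_mono)
    then show ?thesis using r_ge_1 by (simp add: algebra_simps)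
  qed
  define Y where "Y j \<omega> \<longleftrightarrow> (\<exists>i\<in>W' j. X i \<omega> > u)" for j \<omega>
  have Y: "indep_vars (\<lambda>_. count_space UNIV) Y {..k}"
    unfolding Y_def
  proof (rule indep_blocks)
    fix j j' i i' assume *: "j \<noteq> j'" "i \<in> W' j" "i' \<in> W' j'"
    then consider "j < j'" | "j' < j" by linarith
    then show "\<bar>i - i'\<bar> > 2 * r"
    proof cases
      case 1
      then show ?thesis using index_block_separated[OF C(1) 1] * unfolding W'_def by fastforce
    next
      case 2
      then show ?thesis using index_block_separated[OF C(1) 2] * unfolding W'_def by fastforce
    qed
  qed (use fin in auto)
  have probY: "\<P>(\<omega> in M. Y j \<omega>) = block_prob u C k \<nu> j" for j
    unfolding block_prob_def W'_def[symmetric]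
    by (intro arg_cong[of _ _ prob]) (auto simp: Y_def exceed_def)
  define large where "large = {\<omega> \<in> space M. card (exceedances u n \<omega>) > L}"
  define pairs where "pairs = (\<Union>j\<in>{..k}. pair_event u (W j))"
  define in_gap where "in_gap = (\<Union>i\<in>gap. exceed u i)"
  have large: "large \<in> events" unfolding large_def by (rule exceedances_events)
  have pairs: "pairs \<in> events" unfolding pairs_def using fin by (auto intro!: pair_event_events)
  have in_gap: "in_gap \<in> events" unfolding in_gap_def using fin by auto
  have prob_large: "prob large \<le> C * real \<nu> * p u / (real L + 1)"
  proof -
    have "real (nat n) \<le> C * real \<nu>" using C \<nu> by (simp add: n_def)
    then show ?thesis
      using prob_many_exceedances[of L u n] p_nonneg[of u]
      unfolding large_def by (elim order_trans) (intro divide_right_mono mult_right_mono, auto)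
  qed
  have prob_pairs: "prob pairs \<le> (real k + 1) * (w * (\<psi> u + w * (p u)\<^sup>2))"
  proof -
    have "prob pairs \<le> (\<Sum>j\<in>{..k}. prob (pair_event u (W j)))"
      unfolding pairs_def using fin by (intro finite_measure_subadditive_finite) (auto intro!: pair_event_events)
    also have "\<dots> \<le> (\<Sum>j\<in>{..k}. w * (\<psi> u + w * (p u)\<^sup>2))"
      using fin card_index_block(1)[OF C, of 0 \<nu>] unfolding w
      by (intro sum_mono prob_pair_event) (auto simp: W_def)
    finally show ?thesis by (simp add: add.commute)
  qed
  have prob_in_gap: "prob in_gap \<le> (real k + 1) * (2 * of_int r) * p u"
    unfolding in_gap_def
    by (intro order_trans[OF prob_block_le] mult_right_mono card_gap p_nonneg fin)
  have "prob (large \<union> pairs \<union> in_gap) \<le> prob large + prob pairs + prob in_gap"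
    using large pairs in_gap
    by (intro order_trans[OF measure_Un_le] add_right_mono measure_Un_le) auto
  with prob_large prob_pairs prob_in_gap have bad: "prob (large \<union> pairs \<union> in_gap)
      \<le> C * real \<nu> * p u / (real L + 1) + (real k + 1) * (w * (\<psi> u + w * (p u)\<^sup>2)) + (real k + 1) * (2 * of_int r) * p u"
    by linarith
  have Bnn: "B \<ge> 0" using B[of "atoms_measure C {} (\<lambda>_. 0)"] atoms_measure_in_counting_measures[of "{}" "\<lambda>_. 0" C]
    by fastforce
  note meas = exceedance_process_measurable[OF C(1) \<nu>, of u]
  have "\<bar>expectation (\<lambda>\<omega>. h (exceedance_process X C u \<nu> \<omega>))
      - (\<Sum>S\<in>Pow {..k}. h (atoms_measure C S (cell_point C k)) * occupancy_prob (\<lambda>j. \<P>(\<omega> in M. Y j \<omega>)) {..k} S)\<bar>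
    \<le> e + 2 * B * prob (large \<union> pairs \<union> in_gap)"
  proof (rule expectation_approx_occupied_set)
    show "(\<lambda>\<omega>. h (exceedance_process X C u \<nu> \<omega>)) \<in> borel_measurable M"
      using measurable_compose[OF meas h] by simp
    show "\<bar>h (exceedance_process X C u \<nu> \<omega>)\<bar> \<le> B" if "\<omega> \<in> space M" for \<omega>
      using measurable_space[OF meas that] by (intro B) simp
    show "\<bar>h (atoms_measure C S (cell_point C k))\<bar> \<le> B" if "S \<subseteq> {..k}" for S
      using that cell_point_in[OF C] by (intro B atoms_measure_in_counting_measures) (auto intro: finite_subset)
    show "large \<union> pairs \<union> in_gap \<in> events" using large pairs in_gap by auto
    fix \<omega> assume \<omega>: "\<omega> \<in> space M" "\<omega> \<notin> large \<union> pairs \<union> in_gap"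
    let ?I = "exceedances u n \<omega>"
    have I: "i \<in> ?I \<longleftrightarrow> 1 \<le> i \<and> i \<le> n \<and> \<omega> \<in> exceed u i" for i
      using \<omega>(1) by (auto simp: exceedances_def exceed_def)
    have cell_le_k: "cell C k (y i) \<le> k" if "i \<in> ?I" for i
      using eq(2)[of u \<omega>] that by (intro cell_le C) auto
    have "card ?I \<le> L" using \<omega> by (auto simp: large_def)
    moreover have "inj_on (\<lambda>i. cell C k (y i)) ?I"
    proof (rule inj_onI, rule ccontr)
      fix i i' assume i: "i \<in> ?I" "i' \<in> ?I" "cell C k (y i) = cell C k (y i')" "i \<noteq> i'"
      let ?j = "cell C k (y i)"
      have "i \<in> W ?j" "i' \<in> W ?j" using cell_y[of i ?j] cell_y[of i' ?j] i I by auto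
      then have "\<omega> \<in> pair_event u (W ?j)" using i I unfolding pair_event_def by blast
      then show False using \<omega>(2) cell_le_k[OF i(1)] unfolding pairs_def by auto
    qed
    ultimately have "\<bar>h (atoms_measure C ?I y)
        - h (atoms_measure C ((\<lambda>i. cell C k (y i)) ` ?I) (cell_point C k))\<bar> < e"
      using eq(2) by (intro discretise_atoms_measure[OF C d k]) auto
    moreover have "(\<lambda>i. cell C k (y i)) ` ?I = {j \<in> {..k}. Y j \<omega>}"
    proof (intro equalityI subsetI)
      fix j assume "j \<in> (\<lambda>i. cell C k (y i)) ` ?I"
      then obtain i where i: "i \<in> ?I" "j = cell C k (y i)" by blast
      then have j: "j \<le> k" "i \<in> W j" using cell_le_k[OF i(1)] cell_y[of i j] I by auto
      then have "i \<in> W' j" using W_gap[OF j(2,1)] \<omega>(2) i(1) I by (auto simp: in_gap_def)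
      then show "j \<in> {j \<in> {..k}. Y j \<omega>}" using j i(1) by (auto simp: Y_def exceedances_def)
    next
      fix j assume "j \<in> {j \<in> {..k}. Y j \<omega>}"
      then obtain i where i: "j \<le> k" "i \<in> W' j" "X i \<omega> > u" by (auto simp: Y_def)
      then have "i \<in> W j" using W'_subset by blast
      then have "i \<in> ?I" "cell C k (y i) = j"
        using W_range[OF i(1)] i(3) cell_y[of i j] by (auto simp: exceedances_def)
      then show "j \<in> (\<lambda>i. cell C k (y i)) ` ?I" by blast
    qed
    ultimately show "\<bar>h (exceedance_process X C u \<nu> \<omega>) - h (atoms_measure C {j \<in> {..k}. Y j \<omega>} (cell_point C k))\<bar> \<le> e"
      unfolding eq(1) by simp
  qed (use e Y in auto)
  also have "\<dots> \<le> e + 2 * B * (C * real \<nu> * p u / (real L + 1) + (real k + 1) * (w * (\<psi> u + w * (p u)\<^sup>2))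
         + (real k + 1) * (2 * of_int r) * p u)"
    using bad Bnn by (intro add_left_mono mult_left_mono) auto
  finally show ?thesis unfolding probY .
qed

text \<open>Both probabilities are compared with \<open>l / real k\<close>. Relative to
  \<open>w\<close>, a shortened block can lack \<open>2 * r\<close> removed indices and 2 more from
  rounding, since the lower bound has \<open>- 1\<close> where \<open>w\<close> has
  \<open>+ 1\<close>.\<close>

lemma block_prob_approx:
  assumes C: "C > 0" "k > 0" and l: "l \<ge> 0" and w: "w = C * real \<nu> / real k + 1"
  shows "\<bar>block_prob u C k \<nu> j - poisson_occupancy l k j\<bar>
     \<le> \<bar>w * p u - l / real k\<bar> + (2 + 2 * of_int r) * p u + w * (\<psi> u + w * (p u)\<^sup>2) + (l / real k)\<^sup>2"
    (is "_ \<le> ?R")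
proof (cases j)
  case 0
  have "w \<ge> 0" using C w by simp
  then have "?R \<ge> 0" using p_nonneg \<psi>_nonneg r_ge_1 by simp
  then show ?thesis using 0 by (simp add: block_prob_def index_block_def poisson_occupancy_def)
next
  case (Suc i)
  let ?W = "index_block C k \<nu> (2 * r) j"
  have r0: "2 * r \<ge> 0" using r_ge_1 by simp
  have c: "real (card ?W) \<le> w" "real (card ?W) \<ge> w - (2 + 2 * of_int r)"
    using card_index_block(1)[OF C r0, of \<nu> j] card_index_block(2)[OF C r0, of \<nu> i]
    unfolding w Suc by auto
  have "block_prob u C k \<nu> j \<le> w * p u"
    unfolding block_prob_def
    by (intro order_trans[OF prob_block_le] mult_right_mono c p_nonneg) simp
  moreover have "block_prob u C k \<nu> j \<ge> real (card ?W) * p u - w * (\<psi> u + w * (p u)\<^sup>2)"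
    unfolding block_prob_def by (intro prob_block_ge c) simp
  moreover have "real (card ?W) * p u \<ge> (w - (2 + 2 * of_int r)) * p u"
    by (intro mult_right_mono c p_nonneg)
  moreover have "poisson_occupancy l k j \<le> l / real k" "poisson_occupancy l k j \<ge> l / real k - (l / real k)\<^sup>2"
    using poisson_occupancy_bounds[OF l, of j k] C Suc by auto
  moreover have "w * (\<psi> u + w * (p u)\<^sup>2) \<ge> 0" "(2 + 2 * of_int r) * p u \<ge> 0"
    using C w p_nonneg \<psi>_nonneg r_ge_1 by auto
  ultimately show ?thesis by (simp add: left_diff_distrib)
qed

text \<open>Let the threshold grow first and refine the cells afterwards: for a fixed number \<open>k\<close> of cells
  the error tends to a limit of order \<open>1 / k\<close>.\<close>

lemma exceedance_expectation_tendsto: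
  assumes C: "C > 0" and beta: "\<beta> > 0"
    and p_lim: "(\<lambda>\<nu>. real \<nu> * p (t \<nu>)) \<longlonglongrightarrow> \<beta>" and \<psi>_lim: "(\<lambda>\<nu>. real \<nu> * \<psi> (t \<nu>)) \<longlonglongrightarrow> 0"
    and h: "continuous_map (counting_topology C) euclideanreal h"
    and B: "\<And>\<mu>. \<mu> \<in> counting_measures C \<Longrightarrow> \<bar>h \<mu>\<bar> \<le> B"
  shows "(\<lambda>\<nu>. expectation (\<lambda>\<omega>. h (exceedance_process X C (t \<nu>) \<nu> \<omega>)))
     \<longlonglongrightarrow> (\<integral>\<omega>. h (poisson_measure_map C \<omega>) \<partial>poisson_points (\<beta> * C) (uniform_Icc C))"
    (is "?E \<longlonglongrightarrow> ?P")
proof (rule LIMSEQ_I)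
  fix \<eta> :: real assume \<eta>: "\<eta> > 0"
  define l where "l = \<beta> * C"
  have l: "l > 0" using C beta by (simp add: l_def)
  have hm: "h \<in> borel_measurable (borel_of (counting_topology C))"
    using h by (rule continuous_map_borel_measurable)
  have Bnn: "B \<ge> 0" using B[of "atoms_measure C {} (\<lambda>_. 0)"] atoms_measure_in_counting_measures[of "{}" "\<lambda>_. 0" C]
    by fastforce
  define tail where "tail L = measure_pmf.prob (poisson_pmf l) {L<..}" for L :: nat
  have "(\<lambda>L. measure_pmf.prob (poisson_pmf l) {L<..}) \<longlonglongrightarrow> measure_pmf.prob (poisson_pmf l) (\<Inter>L. {L<..})"
    by (intro measure_pmf.finite_Lim_measure_decseq) (auto simp: decseq_def)
  moreover have "(\<Inter>L::nat. {L<..}) = {}" by auto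
  ultimately have "tail \<longlonglongrightarrow> 0" by (simp add: tail_def[abs_def])
  moreover have "(\<lambda>L. l / (real L + 1)) \<longlonglongrightarrow> 0"
    using tendsto_mult[OF tendsto_const[of l] LIMSEQ_inverse_real_of_nat] by (simp add: divide_inverse add.commute)
  \<comment> \<open>Too many points on either side: \<open>tail L\<close> for the Poisson number,
    and \<open>l / (real L + 1)\<close> as the limit of the Markov bound for exceedances.\<close>
  ultimately have "(\<lambda>L. 2 * B * (tail L + l / (real L + 1))) \<longlonglongrightarrow> 2 * B * (0 + 0)"
    by (intro tendsto_intros)
  then have "eventually (\<lambda>L. 2 * B * (tail L + l / (real L + 1)) < \<eta> / 4) sequentially"
    using \<eta> by (intro order_tendstoD) auto
  then obtain L where L: "2 * B * (tail L + l / (real L + 1)) < \<eta> / 4"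
    by (auto simp: eventually_sequentially)
  obtain d where d: "d > 0" "atoms_modulus C h L (\<eta> / 8) d"
    using atoms_modulus_exists[OF C h, of "\<eta> / 8"] \<eta> by auto
  have inv: "(\<lambda>k. c / real k) \<longlonglongrightarrow> 0" for c by (rule lim_const_over_n)
  \<comment> \<open>The 7 is \<open>1 + 3 * 2\<close>: one term from shared Poisson cells, and three
    limits \<open>(real k + 1) * (l / real k)\<^sup>2\<close>, one from \<open>D1\<close> and two
    from \<open>D2\<close>, each at most twice \<open>l\<^sup>2 / real k\<close>.\<close>
  have "(\<lambda>k. 2 * B * (7 * (l\<^sup>2 / real k))) \<longlonglongrightarrow> 2 * B * (7 * 0)"
    by (intro tendsto_intros inv)
  then have "eventually (\<lambda>k. 2 * B * (7 * (l\<^sup>2 / real k)) < \<eta> / 4) sequentially"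
    using \<eta> by (intro order_tendstoD) auto
  moreover have "eventually (\<lambda>k. C / real k < d) sequentially"
    using inv[of C] d(1) by (rule order_tendstoD)
  ultimately have "eventually (\<lambda>k. 2 * B * (7 * (l\<^sup>2 / real k)) < \<eta> / 4 \<and> C / real k < d \<and> k > 0) sequentially"
    using eventually_gt_at_top[of "0::nat"] by eventually_elim auto
  then obtain k where k: "2 * B * (7 * (l\<^sup>2 / real k)) < \<eta> / 4" "C / real k < d" "k > 0"
    by (auto simp: eventually_sequentially)
  define w where "w \<nu> = C * real \<nu> / real k + 1" for \<nu> :: nat
  define D1 where "D1 \<nu> = C * real \<nu> * p (t \<nu>) / (real L + 1)
      + (real k + 1) * (w \<nu> * (\<psi> (t \<nu>) + w \<nu> * (p (t \<nu>))\<^sup>2)) + (real k + 1) * (2 * of_int r) * p (t \<nu>)" for \<nu>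
  define D2 where "D2 \<nu> = \<bar>w \<nu> * p (t \<nu>) - l / real k\<bar> + (2 + 2 * of_int r) * p (t \<nu>)
      + w \<nu> * (\<psi> (t \<nu>) + w \<nu> * (p (t \<nu>))\<^sup>2) + (l / real k)\<^sup>2" for \<nu>
  \<comment> \<open>Three comparisons are added: exceedances with their blocks, Poisson process with
    its cells, and the two occupancy laws with each other.\<close>
  define R where "R \<nu> = 2 * (\<eta> / 8) + 2 * B * (tail L + l\<^sup>2 / real k) + 2 * B * D1 \<nu> + 2 * B * ((real k + 1) * D2 \<nu>)" for \<nu>
  let ?g = "\<lambda>A. h (atoms_measure C A (cell_point C k))"
  have bound: "\<bar>?E \<nu> - ?P\<bar> \<le> R \<nu>" if \<nu>: "\<nu> > 0" for \<nu>
  proof -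
    let ?a = "block_prob (t \<nu>) C k \<nu>" and ?b = "poisson_occupancy l k"
    have 1: "\<bar>?E \<nu> - (\<Sum>A\<in>Pow {..k}. ?g A * occupancy_prob ?a {..k} A)\<bar> \<le> \<eta> / 8 + 2 * B * D1 \<nu>"
      unfolding D1_def using \<eta>
      by (intro exceedance_expectation_approx[OF C k(3) \<nu> hm B d(2) _ k(2)] w_def) auto
    have 2: "\<bar>?P - (\<Sum>A\<in>Pow {..k}. ?g A * occupancy_prob ?b {..k} A)\<bar> \<le> \<eta> / 8 + 2 * B * (tail L + l\<^sup>2 / real k)"
      unfolding tail_def l_def using \<eta>
      by (intro poisson_expectation_approx[OF C k(3) beta hm B d(2) _ k(2)]) auto
    have "\<bar>(\<Sum>A\<in>Pow {..k}. ?g A * occupancy_prob ?a {..k} A) - (\<Sum>A\<in>Pow {..k}. ?g A * occupancy_prob ?b {..k} A)\<bar>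
        \<le> 2 * B * (\<Sum>j\<in>{..k}. \<bar>?a j - ?b j\<bar>)"
    proof (rule sum_weighted_occupancy_diff)
      show "?a j \<in> {0..1}" for j by (simp add: block_prob_def)
      show "?b j \<in> {0..1}" for j using l by (simp add: poisson_occupancy_def)
      show "\<bar>?g A\<bar> \<le> B" if "A \<subseteq> {..k}" for A
        using that cell_point_in[OF C k(3)]
        by (intro B atoms_measure_in_counting_measures) (auto intro: finite_subset)
    qed simp
    also have "\<dots> \<le> 2 * B * (\<Sum>j\<in>{..k}. D2 \<nu>)"
      unfolding D2_def using Bnn l
      by (intro mult_left_mono sum_mono block_prob_approx[OF C k(3)] w_def) auto
    also have "\<dots> = 2 * B * ((real k + 1) * D2 \<nu>)" by (simp add: add.commute)
    finally show ?thesis using 1 2 unfolding R_def by linarith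
  qed
  have p0: "(\<lambda>\<nu>. p (t \<nu>)) \<longlonglongrightarrow> 0"
  proof (rule Lim_transform_eventually)
    show "(\<lambda>\<nu>. real \<nu> * p (t \<nu>) * (1 / real \<nu>)) \<longlonglongrightarrow> 0"
      using tendsto_mult[OF p_lim inv[of 1]] by simp
    show "eventually (\<lambda>\<nu>. real \<nu> * p (t \<nu>) * (1 / real \<nu>) = p (t \<nu>)) sequentially"
      using eventually_gt_at_top[of "0::nat"] by eventually_elim simp
  qed
  have \<psi>0: "(\<lambda>\<nu>. \<psi> (t \<nu>)) \<longlonglongrightarrow> 0"
  proof (rule Lim_transform_eventually)
    show "(\<lambda>\<nu>. real \<nu> * \<psi> (t \<nu>) * (1 / real \<nu>)) \<longlonglongrightarrow> 0"
      using tendsto_mult[OF \<psi>_lim inv[of 1]] by simp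
    show "eventually (\<lambda>\<nu>. real \<nu> * \<psi> (t \<nu>) * (1 / real \<nu>) = \<psi> (t \<nu>)) sequentially"
      using eventually_gt_at_top[of "0::nat"] by eventually_elim simp
  qed
  have wp: "(\<lambda>\<nu>. w \<nu> * p (t \<nu>)) \<longlonglongrightarrow> l / real k"
  proof -
    have "(\<lambda>\<nu>. C / real k * (real \<nu> * p (t \<nu>)) + p (t \<nu>)) \<longlonglongrightarrow> C / real k * \<beta> + 0"
      by (intro tendsto_intros p_lim p0)
    then show ?thesis by (simp add: w_def l_def algebra_simps)
  qed
  have w\<psi>: "(\<lambda>\<nu>. w \<nu> * \<psi> (t \<nu>)) \<longlonglongrightarrow> 0"
  proof -
    have "(\<lambda>\<nu>. C / real k * (real \<nu> * \<psi> (t \<nu>)) + \<psi> (t \<nu>)) \<longlonglongrightarrow> C / real k * 0 + 0"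
      by (intro tendsto_intros \<psi>_lim \<psi>0)
    then show ?thesis by (simp add: w_def algebra_simps)
  qed
  \<comment> \<open>Close pairs disappear in the limit because
    \<open>w \<nu> * \<psi> (t \<nu>)\<close> tends to 0; the independent pairs leave
    \<open>(l / real k)\<^sup>2\<close>.\<close>
  have q: "(\<lambda>\<nu>. w \<nu> * (\<psi> (t \<nu>) + w \<nu> * (p (t \<nu>))\<^sup>2)) \<longlonglongrightarrow> (l / real k)\<^sup>2"
  proof -
    have "(\<lambda>\<nu>. w \<nu> * \<psi> (t \<nu>) + (w \<nu> * p (t \<nu>))\<^sup>2) \<longlonglongrightarrow> 0 + (l / real k)\<^sup>2"
      by (intro tendsto_intros wp w\<psi>)
    then show ?thesis by (simp add: algebra_simps power2_eq_square)
  qed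
  have "D1 \<longlonglongrightarrow> C * \<beta> / (real L + 1) + (real k + 1) * (l / real k)\<^sup>2 + (real k + 1) * (2 * of_int r) * 0"
    unfolding D1_def mult.assoc[of C] by (intro tendsto_intros p_lim q p0) simp
  moreover have "D2 \<longlonglongrightarrow> \<bar>l / real k - l / real k\<bar> + (2 + 2 * of_int r) * 0 + (l / real k)\<^sup>2 + (l / real k)\<^sup>2"
    unfolding D2_def by (intro tendsto_intros wp q p0)
  ultimately have "R \<longlonglongrightarrow> 2 * (\<eta> / 8) + 2 * B * (tail L + l\<^sup>2 / real k)
      + 2 * B * (C * \<beta> / (real L + 1) + (real k + 1) * (l / real k)\<^sup>2 + (real k + 1) * (2 * of_int r) * 0)
      + 2 * B * ((real k + 1) * (\<bar>l / real k - l / real k\<bar> + (2 + 2 * of_int r) * 0 + (l / real k)\<^sup>2 + (l / real k)\<^sup>2))"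
    (is "R \<longlonglongrightarrow> ?R")
    unfolding R_def by (intro tendsto_intros)
  \<comment> \<open>The discretisation errors and the choices of \<open>L\<close> and
    \<open>k\<close> contribute at most \<open>\<eta> / 4\<close> each.\<close>
  moreover have "?R < \<eta>"
  proof -
    have "(real k + 1) * (l / real k)\<^sup>2 \<le> (2 * real k) * (l / real k)\<^sup>2"
      using k(3) by (intro mult_right_mono) auto
    also have "\<dots> = 2 * (l\<^sup>2 / real k)" using k(3) by (simp add: power2_eq_square)
    finally have "2 * B * ((real k + 1) * (l / real k)\<^sup>2) \<le> 2 * B * (2 * (l\<^sup>2 / real k))"
      using Bnn by (intro mult_left_mono) auto
    also have "\<dots> = 2 * (2 * B * (l\<^sup>2 / real k))" by simp
    finally have kk: "2 * B * ((real k + 1) * (l / real k)\<^sup>2) \<le> \<dots>" .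
    have k1: "7 * (2 * B * (l\<^sup>2 / real k)) < \<eta> / 4" using k(1) by simp
    have "?R = \<eta> / 4 + 2 * B * (tail L + l / (real L + 1)) + 2 * B * (l\<^sup>2 / real k)
        + 3 * (2 * B * ((real k + 1) * (l / real k)\<^sup>2))"
      by (simp add: l_def algebra_simps)
    also have "\<dots> < \<eta>" using kk L k1 \<eta> by argo
    finally show ?thesis .
  qed
  ultimately have "eventually (\<lambda>\<nu>. R \<nu> < \<eta>) sequentially" by (rule order_tendstoD)
  then have "eventually (\<lambda>\<nu>. norm (?E \<nu> - ?P) < \<eta>) sequentially"
    using eventually_gt_at_top[of "0::nat"]
  proof eventually_elim
    case (elim \<nu>)
    then show ?case using bound[of \<nu>] by simp
  qed
  then show "\<exists>N. \<forall>\<nu>\<ge>N. norm (?E \<nu> - ?P) < \<eta>"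
    by (simp add: eventually_sequentially)
qed

end

theorem theorem3p2:
  fixes M :: "'a measure"
    and \<epsilon> :: "int \<Rightarrow> 'a \<Rightarrow> real"
    and \<theta> :: "int \<Rightarrow> real"
    and X :: "int \<Rightarrow> 'a \<Rightarrow> real"
    and \<alpha> \<beta> C :: real
    and t :: "nat \<Rightarrow> real"
  assumes "prob_space M"
    and "prob_space.indep_vars M (\<lambda>_. borel) \<epsilon> UNIV"
    and "\<And>i. distr M borel (\<epsilon> i) = distr M borel (\<epsilon> 0)"
    and "finite {k. \<theta> k \<noteq> 0}"
    and "\<exists>k. \<theta> k \<noteq> 0"
    and "X = moving_average \<theta> \<epsilon>"
    and "0 < \<alpha>" and "\<alpha> < 1"
    and "\<beta> = - ln (1 - \<alpha>)"
    and "(\<lambda>\<nu>. \<P>(\<omega> in M. X 0 \<omega> > t \<nu>) - \<beta> / real \<nu>) \<in> o(\<lambda>\<nu>. 1 / real \<nu>)"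
    and "\<And>x. \<P>(\<omega> in M. X 0 \<omega> > x) > 0"
    and "\<And>i0::int. i0 \<ge> 1 \<Longrightarrow>
           ((\<lambda>x. \<P>(\<omega> in M. (\<exists>i. 1 \<le> \<bar>i\<bar> \<and> \<bar>i\<bar> \<le> i0 \<and> X i \<omega> > x) \<bar> X 0 \<omega> > x)) \<longlongrightarrow> 0) at_top"
    and "C > 0"
  shows "\<exists>P. poisson_process_law C \<beta> P \<and>
           converges_in_distribution (counting_topology C) M
             (\<lambda>n. exceedance_process X C (t (Suc n)) (Suc n)) P"
proof -
  obtain r :: int where r: "r \<ge> 1" "\<And>k. \<theta> k \<noteq> 0 \<Longrightarrow> \<bar>k\<bar> \<le> r"
  proof -
    \<comment> \<open>The inserted 1 guarantees \<open>r \<ge> 1\<close>.\<close>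
    let ?S = "insert 1 (abs ` {k. \<theta> k \<noteq> 0})"
    have "finite ?S" using assms(4) by simp
    then have "x \<le> Max ?S" if "x \<in> ?S" for x using that by (rule Max_ge)
    then show ?thesis using that[of "Max ?S"] by auto
  qed
  interpret prob_space M by fact
  interpret MA: moving_average_process M \<epsilon> \<theta> r
    by unfold_locales (use assms(2,3) r in auto)
  have X: "X = moving_average \<theta> \<epsilon>" by fact
  have beta: "\<beta> > 0" using assms(7,8,9) by simp
  have p_eq: "MA.p u = \<P>(\<omega> in M. X 0 \<omega> > u)" for u by (simp add: MA.p_def MA.exceed_def X)
  have p_lim: "(\<lambda>\<nu>. real \<nu> * MA.p (t \<nu>)) \<longlonglongrightarrow> \<beta>"
  proof -
    have "(\<lambda>\<nu>. (MA.p (t \<nu>) - \<beta> / real \<nu>) / (1 / real \<nu>)) \<longlonglongrightarrow> 0"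
      using smalloD_tendsto[OF assms(10)] by (simp add: p_eq)
    then have "(\<lambda>\<nu>. (MA.p (t \<nu>) - \<beta> / real \<nu>) / (1 / real \<nu>) + \<beta>) \<longlonglongrightarrow> 0 + \<beta>"
      by (intro tendsto_intros)
    moreover have "eventually (\<lambda>\<nu>. (MA.p (t \<nu>) - \<beta> / real \<nu>) / (1 / real \<nu>) + \<beta> = real \<nu> * MA.p (t \<nu>)) sequentially"
      using eventually_gt_at_top[of "0::nat"] by eventually_elim (simp add: field_simps)
    ultimately show ?thesis by (simp add: Lim_transform_eventually)
  qed
  have p0: "(\<lambda>\<nu>. MA.p (t \<nu>)) \<longlonglongrightarrow> 0"
  proof (rule Lim_transform_eventually)
    show "(\<lambda>\<nu>. real \<nu> * MA.p (t \<nu>) * (1 / real \<nu>)) \<longlonglongrightarrow> 0"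
      using tendsto_mult[OF p_lim lim_const_over_n[of 1]] by simp
    show "eventually (\<lambda>\<nu>. real \<nu> * MA.p (t \<nu>) * (1 / real \<nu>) = MA.p (t \<nu>)) sequentially"
      using eventually_gt_at_top[of "0::nat"] by eventually_elim simp
  qed
  \<comment> \<open>Tail probabilities decrease in the level, and \<open>MA.p Z\<close> is positive
    for every \<open>Z\<close>; once \<open>MA.p (t \<nu>)\<close> is smaller,
    \<open>t \<nu>\<close> cannot lie below \<open>Z\<close>.\<close>
  have t_lim: "filterlim t at_top sequentially"
    unfolding filterlim_at_top
  proof
    fix Z
    have "eventually (\<lambda>\<nu>. MA.p (t \<nu>) < MA.p Z) sequentially"
      using p0 assms(11)[of Z] by (intro order_tendstoD) (auto simp: p_eq)
    then show "eventually (\<lambda>\<nu>. Z \<le> t \<nu>) sequentially"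
    proof eventually_elim
      case (elim \<nu>)
      have "MA.p Z \<le> MA.p (t \<nu>)" if "t \<nu> < Z"
        unfolding MA.p_def using that by (intro finite_measure_mono) (auto simp: MA.exceed_def)
      then show ?case using elim by linarith
    qed
  qed
  have \<psi>_eq: "MA.\<psi> u = MA.p u * \<P>(\<omega> in M. (\<exists>i. 1 \<le> \<bar>i\<bar> \<and> \<bar>i\<bar> \<le> 2 * r \<and> X i \<omega> > u) \<bar> X 0 \<omega> > u)" for u
    using assms(11)[of u] by (simp add: MA.\<psi>_def p_eq cond_prob_def X)
  \<comment> \<open>\<open>real \<nu> * MA.\<psi> (t \<nu>)\<close> is
    \<open>real \<nu> * MA.p (t \<nu>)\<close>, which tends to \<open>\<beta>\<close>, times the
    conditional probability for \<open>i0 = 2 * r\<close>, which tends to 0.\<close>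
  have \<psi>_lim: "(\<lambda>\<nu>. real \<nu> * MA.\<psi> (t \<nu>)) \<longlonglongrightarrow> 0"
  proof -
    have "1 \<le> 2 * r" using r(1) by simp
    from tendsto_mult[OF p_lim filterlim_compose[OF assms(12)[OF this] t_lim]]
    show ?thesis by (simp add: \<psi>_eq mult.assoc)
  qed
  let ?T = "counting_topology C"
  let ?Q = "poisson_points (\<beta> * C) (uniform_Icc C)"
  let ?P = "distr ?Q (borel_of ?T) (poisson_measure_map C)"
  have law: "poisson_process_law C \<beta> ?P"
    using \<open>C > 0\<close> beta by (rule poisson_process_law_distr)
  moreover have "converges_in_distribution ?T M (\<lambda>n. exceedance_process X C (t (Suc n)) (Suc n)) ?P"
    unfolding converges_in_distribution_def
  proof (intro conjI allI impI)
    show "exceedance_process X C (t (Suc n)) (Suc n) \<in> M \<rightarrow>\<^sub>M borel_of ?T" for n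
      unfolding X using \<open>C > 0\<close> by (intro MA.exceedance_process_measurable) auto
    show "prob_space ?P" "sets ?P = sets (borel_of ?T)" using law by (auto simp: poisson_process_law_def)
    fix h assume h: "continuous_map ?T euclideanreal h" "\<exists>B. \<forall>\<mu>\<in>topspace ?T. \<bar>h \<mu>\<bar> \<le> B"
    then obtain B where B: "\<And>\<mu>. \<mu> \<in> counting_measures C \<Longrightarrow> \<bar>h \<mu>\<bar> \<le> B" by auto
    \<comment> \<open>The sequence in the statement starts at \<open>\<nu> = 1\<close>, so the limit
      is shifted by one index.\<close>
    have "(\<lambda>n. \<integral>\<omega>. h (exceedance_process X C (t (Suc n)) (Suc n) \<omega>) \<partial>M)
        \<longlonglongrightarrow> (\<integral>\<omega>. h (poisson_measure_map C \<omega>) \<partial>?Q)"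
      unfolding X
      using MA.exceedance_expectation_tendsto[OF \<open>C > 0\<close> beta p_lim \<psi>_lim h(1) B, THEN LIMSEQ_Suc] .
    moreover have "(\<integral>\<mu>. h \<mu> \<partial>?P) = (\<integral>\<omega>. h (poisson_measure_map C \<omega>) \<partial>?Q)"
      using measurable_poisson_measure_map[OF \<open>C > 0\<close>] continuous_map_borel_measurable[OF h(1)]
      by (intro integral_distr) auto
    ultimately show "(\<lambda>n. \<integral>\<omega>. h (exceedance_process X C (t (Suc n)) (Suc n) \<omega>) \<partial>M) \<longlonglongrightarrow> (\<integral>\<mu>. h \<mu> \<partial>?P)"
      by simp
  qed
  ultimately show ?thesis by blast
qed

end
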